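(* For all $i\in\{1,2,3\}$, $\lambda\in\mathbb C^3$ and $\nu\in\mathbb C^2$, one has $m_i(\nu,\lambda)\leq1$.
   Context: $\mathfrak g=\mathfrak{gl}(3,\mathbb C)=\mathfrak n_-\oplus\mathfrak a\oplus\mathfrak n_+$ with $\mathfrak a$ the diagonal matrices, $\mathfrak n_-$ (resp. $\mathfrak n_+$) strictly lower (resp. upper) triangular matrices, $\mathfrak b=\mathfrak a\oplus\mathfrak n_+$. For $\lambda\in\mathbb C^3$, $\mathbb C_\lambda$ is the character $\mathrm{diag}(z_1,z_2,z_3)\mapsto\sum\lambda_jz_j$ of $\mathfrak a$ and $M^{\mathfrak g}_{\mathfrak b}(\lambda)=U(\mathfrak g)\otimes_{U(\mathfrak b)}\mathbb C_\lambda$ the Verma module. Embeddings $\mathfrak{gl}(2,\mathbb C)\hookrightarrow\mathfrak g$: $\iota_1(X)=\begin{pmatrix}X&0\\0&0\end{pmatrix}$, $\iota_2(X)=\begin{pmatrix}0&0\\0&X\end{pmatrix}$, $\iota_3\begin{pmatrix}a&b\\c&d\end{pmatrix}=\begin{pmatrix}a&0&b\\0&0&0\\c&0&d\end{pmatrix}$. Put $\mathfrak g_i'=\iota_i(\mathfrak{gl}(2,\mathbb C))$, $\mathfrak a_i'=\mathfrak a\cap\mathfrak g_i'$, $\mathfrak b_i'=\mathfrak b\cap\mathfrak g_i'$, $\mathfrak n_{i,-}'=\mathfrak n_-\cap\mathfrak g_i'$. For $\nu\in\mathbb C^2$, $\mathbb C_\nu$ is the character $\iota_i(\mathrm{diag}(z_1,z_2))\mapsto\nu_1z_1+\nu_2z_2$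 of $\mathfrak a_i'$ and $M^{\mathfrak g_i'}_{\mathfrak b_i'}(\nu)$ the corresponding Verma module. $m_i(\nu,\lambda)=\dim_{\mathbb C}\mathrm{Hom}_{\mathfrak a_i'}(\mathbb C_\nu,\mathbb C_\lambda|_{\mathfrak a_i'}\otimes S(\mathfrak n_-/\mathfrak n_{i,-}'))$, where $S(\cdot)$ is the symmetric algebra with the adjoint action; by Kobayashi's character identity this is the multiplicity of $[M^{\mathfrak g_i'}_{\mathfrak b_i'}(\nu)]$ in the branching law $[M^{\mathfrak g}_{\mathfrak b}(\lambda)|_{\mathfrak g_i'}]=\bigoplus_\nu m_i(\nu,\lambda)[M^{\mathfrak g_i'}_{\mathfrak b_i'}(\nu)]$ in the Grothendieck group (formal characters). *)

theory Defs
  imports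
    "HOL-Analysis.Analysis"
    "HOL-Library.Poly_Mapping"
    "HOL-Library.Extended_Nat"
    "HOL-Algebra.QuotRing"
    "Jordan_Normal_Form.Missing_VectorSpace"
begin

hide_const (open) Multiset.mult Polynomial.smult

section \<open>Complex vector spaces with explicit carriers\<close>

text \<open>
  Vector spaces are \<open>module\<close> records of HOL-Algebra over the field below. Where a record only
  stands for a vector space, its ring fields \<open>mult\<close> and \<open>one\<close> carry no meaning.
\<close>

definition complex_field :: "complex ring" where
  "complex_field = \<lparr>carrier = UNIV, mult = (*), one = 1, zero = 0, add = (+)\<rparr>"

definition complex_line :: "(complex, complex) module" where
  "complex_line = ring.extend complex_field (module.fields (*))"

text \<open>
  The dimension in \<^theory>\<open>VectorSpace.VectorSpace\<close> is a \<open>LEAST\<close> over finite generating sets and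
  is unspecified on infinite-dimensional spaces; these get the value \<open>\<infinity>\<close> here.
\<close>

definition vs_dim :: "(complex, 'v) module \<Rightarrow> enat" where
  "vs_dim V = (if vectorspace.fin_dim complex_field V
               then enat (vectorspace.dim complex_field V) else \<infinity>)"

text \<open>
  The quotient of a vector space by a subspace and, at the same time, of an algebra by an ideal.
\<close>

definition quot_module :: "(complex, 'v) module \<Rightarrow> 'v set \<Rightarrow> (complex, 'v set) module" where
  "quot_module M N = ring.extend (M Quot N)
     (module.fields (\<lambda>c X. \<Union>x\<in>X. N +>\<^bsub>M\<^esub> (c \<odot>\<^bsub>M\<^esub> x)))"

text \<open>The endomorphism of the quotient induced by an endomorphism \<open>T\<close> with \<open>T ` N \<subseteq> N\<close>.\<close>

definition quot_map :: "(complex, 'v) module \<Rightarrow> 'v set \<Rightarrow> ('v \<Rightarrow> 'v) \<Rightarrow> 'v set \<Rightarrow> 'v set" where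
  "quot_map M N T X = (\<Union>x\<in>X. N +>\<^bsub>M\<^esub> T x)"


section \<open>Tensor products\<close>

definition free_space :: "'s set \<Rightarrow> (complex, 's \<Rightarrow>\<^sub>0 complex) module" where
  "free_space S = \<lparr>carrier = {p. Poly_Mapping.keys p \<subseteq> S},
     mult = (\<lambda>_ _. 0), one = 0, zero = 0, add = (+),
     smult = (\<lambda>c. Poly_Mapping.map ((*) c))\<rparr>"

definition tensor_relations ::
  "(complex, 'v) module \<Rightarrow> (complex, 'w) module \<Rightarrow> ('v \<times> 'w \<Rightarrow>\<^sub>0 complex) set" where
  "tensor_relations V W =
     {Poly_Mapping.single (x \<oplus>\<^bsub>V\<^esub> x', y) 1
        - Poly_Mapping.single (x, y) 1 - Poly_Mapping.single (x', y) 1 | x x' y.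
        x \<in> carrier V \<and> x' \<in> carrier V \<and> y \<in> carrier W} \<union>
     {Poly_Mapping.single (x, y \<oplus>\<^bsub>W\<^esub> y') 1
        - Poly_Mapping.single (x, y) 1 - Poly_Mapping.single (x, y') 1 | x y y'.
        x \<in> carrier V \<and> y \<in> carrier W \<and> y' \<in> carrier W} \<union>
     {Poly_Mapping.single (c \<odot>\<^bsub>V\<^esub> x, y) 1 - Poly_Mapping.single (x, y) c | c x y.
        x \<in> carrier V \<and> y \<in> carrier W} \<union>
     {Poly_Mapping.single (x, c \<odot>\<^bsub>W\<^esub> y) 1 - Poly_Mapping.single (x, y) c | c x y.
        x \<in> carrier V \<and> y \<in> carrier W}"

definition tensor_kernel ::
  "(complex, 'v) module \<Rightarrow> (complex, 'w) module \<Rightarrow> ('v \<times> 'w \<Rightarrow>\<^sub>0 complex) set" where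
  "tensor_kernel V W =
     module.span complex_field (free_space (carrier V \<times> carrier W)) (tensor_relations V W)"

definition tensor_space ::
  "(complex, 'v) module \<Rightarrow> (complex, 'w) module \<Rightarrow> (complex, ('v \<times> 'w \<Rightarrow>\<^sub>0 complex) set) module" where
  "tensor_space V W = quot_module (free_space (carrier V \<times> carrier W)) (tensor_kernel V W)"

text \<open>The Lie algebra action on a tensor product: \<open>x \<otimes> y \<mapsto> A x \<otimes> y + x \<otimes> B y\<close>.\<close>

definition tensor_action ::
  "(complex, 'v) module \<Rightarrow> (complex, 'w) module \<Rightarrow> ('v \<Rightarrow> 'v) \<Rightarrow> ('w \<Rightarrow> 'w) \<Rightarrow>
   ('v \<times> 'w \<Rightarrow>\<^sub>0 complex) set \<Rightarrow> ('v \<times> 'w \<Rightarrow>\<^sub>0 complex) set" where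
  "tensor_action V W A B =
     quot_map (free_space (carrier V \<times> carrier W)) (tensor_kernel V W)
       (\<lambda>p. \<Sum>(x, y)\<in>Poly_Mapping.keys p.
          Poly_Mapping.single (A x, y) (Poly_Mapping.lookup p (x, y))
          + Poly_Mapping.single (x, B y) (Poly_Mapping.lookup p (x, y)))"


section \<open>Symmetric algebras\<close>

text \<open>
  The polynomial algebra with one indeterminate for every element of \<open>S\<close>. Monomials are finite
  multisets over \<open>S\<close>, so \<open>Poly_Mapping.single {#v#} 1\<close> is the indeterminate of \<open>v\<close> and
  \<open>Poly_Mapping.single {#} c\<close> is the constant \<open>c\<close>; the product is the convolution product.
\<close>

definition poly_alg :: "'s set \<Rightarrow> (complex, 's multiset \<Rightarrow>\<^sub>0 complex) module" where
  "poly_alg S = \<lparr>carrier = {p. \<forall>m\<in>Poly_Mapping.keys p. set_mset m \<subseteq> S},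
     mult = (*), one = 1, zero = 0, add = (+),
     smult = (\<lambda>c p. Poly_Mapping.single {#} c * p)\<rparr>"

text \<open>
  The symmetric algebra is the free commutative algebra on the vector space \<open>V\<close>: the polynomial
  algebra on the set of all vectors modulo the relations that make the map from \<open>V\<close> linear.
\<close>

definition sym_relations :: "(complex, 'v) module \<Rightarrow> ('v multiset \<Rightarrow>\<^sub>0 complex) set" where
  "sym_relations V =
     {Poly_Mapping.single {#x \<oplus>\<^bsub>V\<^esub> y#} 1
        - Poly_Mapping.single {#x#} 1 - Poly_Mapping.single {#y#} 1 | x y.
        x \<in> carrier V \<and> y \<in> carrier V} \<union>
     {Poly_Mapping.single {#c \<odot>\<^bsub>V\<^esub> x#} 1 - Poly_Mapping.single {#x#} c | c x.
        x \<in> carrier V}"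

definition sym_ideal :: "(complex, 'v) module \<Rightarrow> ('v multiset \<Rightarrow>\<^sub>0 complex) set" where
  "sym_ideal V = Idl\<^bsub>poly_alg (carrier V)\<^esub> (sym_relations V)"

definition sym_alg ::
  "(complex, 'v) module \<Rightarrow> (complex, ('v multiset \<Rightarrow>\<^sub>0 complex) set) module" where
  "sym_alg V = quot_module (poly_alg (carrier V)) (sym_ideal V)"

text \<open>
  An endomorphism \<open>T\<close> of \<open>V\<close> acts on the symmetric algebra by the derivation extending it:
  a product of vectors goes to the sum, over its factors \<open>v\<close>, of the products with \<open>v\<close> replaced
  by \<open>T v\<close> (the sum over a multiset counts repeated factors with their multiplicity).
\<close>

definition sym_action ::
  "(complex, 'v) module \<Rightarrow> ('v \<Rightarrow> 'v) \<Rightarrow>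
   ('v multiset \<Rightarrow>\<^sub>0 complex) set \<Rightarrow> ('v multiset \<Rightarrow>\<^sub>0 complex) set" where
  "sym_action V T = quot_map (poly_alg (carrier V)) (sym_ideal V)
     (\<lambda>p. \<Sum>m\<in>Poly_Mapping.keys p. \<Sum>v\<in>#m.
        Poly_Mapping.single (add_mset (T v) (m - {#v#})) (Poly_Mapping.lookup p m))"


section \<open>Intertwining operators\<close>

text \<open>
  The space of linear maps \<open>V \<rightarrow> W\<close> commuting with the actions \<open>\<rho>\<close> and \<open>\<sigma>\<close> of the elements of
  \<open>h\<close>. Maps are \<open>extensional\<close>, so that they are determined by their values on the carrier.
\<close>

definition hom_space ::
  "'g set \<Rightarrow> (complex, 'v) module \<Rightarrow> ('g \<Rightarrow> 'v \<Rightarrow> 'v) \<Rightarrow>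
   (complex, 'w) module \<Rightarrow> ('g \<Rightarrow> 'w \<Rightarrow> 'w) \<Rightarrow> (complex, 'v \<Rightarrow> 'w) module" where
  "hom_space h V \<rho> W \<sigma> =
     \<lparr>carrier = {f \<in> module_hom complex_field V W \<inter> extensional (carrier V).
                   \<forall>H\<in>h. \<forall>x\<in>carrier V. f (\<rho> H x) = \<sigma> H (f x)},
      mult = (\<lambda>_ _. \<lambda>x\<in>carrier V. \<zero>\<^bsub>W\<^esub>),
      one = (\<lambda>x\<in>carrier V. \<zero>\<^bsub>W\<^esub>),
      zero = (\<lambda>x\<in>carrier V. \<zero>\<^bsub>W\<^esub>),
      add = (\<lambda>f g. \<lambda>x\<in>carrier V. f x \<oplus>\<^bsub>W\<^esub> g x),
      smult = (\<lambda>c f. \<lambda>x\<in>carrier V. c \<odot>\<^bsub>W\<^esub> f x)\<rparr>"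


section \<open>Subalgebras of the general linear Lie algebra\<close>

definition lie_bracket :: "complex^'n^'n \<Rightarrow> complex^'n^'n \<Rightarrow> complex^'n^'n" where
  "lie_bracket A B = A ** B - B ** A"

definition mat_space :: "(complex^'n^'n) set \<Rightarrow> (complex, complex^'n^'n) module" where
  "mat_space S = \<lparr>carrier = S, mult = (**), one = mat 1, zero = 0, add = (+),
     smult = (\<lambda>c A. \<chi> j k. c * A $ j $ k)\<rparr>"

definition diag_subalg :: "(complex^3^3) set" where
  "diag_subalg = {vector [vector [a, 0, 0], vector [0, b, 0], vector [0, 0, c]] | a b c. True}"

definition n_minus :: "(complex^3^3) set" where
  "n_minus = {vector [vector [0, 0, 0], vector [a, 0, 0], vector [b, c, 0]] | a b c. True}"

text \<open>Only \<open>i = 1, 2, 3\<close> are meaningful; any other index falls into the last case.\<close>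

definition iota :: "nat \<Rightarrow> complex^2^2 \<Rightarrow> complex^3^3" where
  "iota i X =
     (if i = 1 then
        vector [vector [X$1$1, X$1$2, 0],
                vector [X$2$1, X$2$2, 0],
                vector [0,     0,     0]]
      else if i = 2 then
        vector [vector [0, 0,     0    ],
                vector [0, X$1$1, X$1$2],
                vector [0, X$2$1, X$2$2]]
      else
        vector [vector [X$1$1, 0, X$1$2],
                vector [0,     0, 0    ],
                vector [X$2$1, 0, X$2$2]])"

definition g_sub :: "nat \<Rightarrow> (complex^3^3) set" where
  "g_sub i = range (iota i)"

definition a_sub :: "nat \<Rightarrow> (complex^3^3) set" where
  "a_sub i = diag_subalg \<inter> g_sub i"

definition n_minus_sub :: "nat \<Rightarrow> (complex^3^3) set" where
  "n_minus_sub i = n_minus \<inter> g_sub i"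

definition char3 :: "complex^3 \<Rightarrow> complex^3^3 \<Rightarrow> complex" where
  "char3 lam H = (\<Sum>j\<in>UNIV. lam $ j * H $ j $ j)"

text \<open>On \<open>iota i (diag (z\<^sub>1, z\<^sub>2))\<close> this is \<open>\<nu>\<^sub>1 z\<^sub>1 + \<nu>\<^sub>2 z\<^sub>2\<close>, because \<open>iota i\<close> is injective.\<close>

definition char2 :: "nat \<Rightarrow> complex^2 \<Rightarrow> complex^3^3 \<Rightarrow> complex" where
  "char2 i \<nu> H = (let Z = inv_into UNIV (iota i) H in \<Sum>j\<in>UNIV. \<nu> $ j * Z $ j $ j)"


section \<open>The branching multiplicity\<close>

definition n_quot :: "nat \<Rightarrow> (complex, (complex^3^3) set) module" where
  "n_quot i = quot_module (mat_space n_minus) (n_minus_sub i)"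

definition n_quot_action :: "nat \<Rightarrow> complex^3^3 \<Rightarrow> (complex^3^3) set \<Rightarrow> (complex^3^3) set" where
  "n_quot_action i H = quot_map (mat_space n_minus) (n_minus_sub i) (lie_bracket H)"

definition branching_mult :: "nat \<Rightarrow> complex^2 \<Rightarrow> complex^3 \<Rightarrow> enat" where
  "branching_mult i \<nu> lam = vs_dim (hom_space (a_sub i)
     complex_line (\<lambda>H z. char2 i \<nu> H * z)
     (tensor_space complex_line (sym_alg (n_quot i)))
     (\<lambda>H. tensor_action complex_line (sym_alg (n_quot i))
        (\<lambda>z. char3 lam H * z)
        (sym_action (n_quot i) (n_quot_action i H))))"

end

theory Submission
  imports Defs
begin

text \<open>
  Let \<open>Q\<close> be the quotient of the strictly lower triangular matrices by those in the \<open>i\<close>-th copy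
  of \<open>gl(2)\<close>. It is two-dimensional, and the diagonal matrices of that copy act on it by two roots
  that are linearly independent as functionals. Hence some such matrix \<open>H\<close> has the eigenvalues \<open>1\<close>
  and \<open>\<i>\<close> on \<open>Q\<close>. On the monomial \<open>u^a v^b\<close> in the two eigenvectors \<open>H\<close> acts by \<open>a + b \<i>\<close>, and
  these numbers are pairwise different; twisting by a character shifts all of them by one constant.
  So every eigenspace of \<open>H\<close> on the twisted symmetric algebra is at most a line. An intertwining
  operator from a one-dimensional representation is determined by the image of \<open>1\<close>, which is an
  eigenvector of \<open>H\<close> with prescribed eigenvalue, so these operators form a space of dimension at
  most one.

  Since an upper bound is wanted, it suffices that the monomials span the symmetric algebra and that
  their eigenvalues are different (\<open>eigenspace_in_line\<close>). The rest of the work is to see that the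
  quotients defining tensor products and symmetric algebras are vector spaces on which the actions
  are well defined and linear. On a tensor product this holds because the action on the free space
  preserves the span of the relations (\<open>lift_action_K\<close>); on a symmetric algebra, because a
  derivation of the polynomial algebra that preserves the generators of an ideal preserves the ideal
  (\<open>derivation_I\<close>). Both parts meet in \<open>vs_dim_hom_twisted_sym_alg_le_1\<close>, which concerns any space
  spanned by a family of eigenvectors for which the sums of eigenvalues over different multisets of
  indices are different.
\<close>

section \<open>Complex vector spaces\<close>

lemma complex_field_simps [simp]:
  "carrier complex_field = UNIV" "(\<otimes>\<^bsub>complex_field\<^esub>) = (*)" "\<one>\<^bsub>complex_field\<^esub> = 1"
  "\<zero>\<^bsub>complex_field\<^esub> = 0" "(\<oplus>\<^bsub>complex_field\<^esub>) = (+)"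
  by (simp_all add: complex_field_def)

lemma field_complex_field: "field complex_field"
proof (rule cring.cring_fieldI2)
  show "cring complex_field"
  proof (intro cringI abelian_groupI comm_monoidI)
    fix x :: complex
    show "\<exists>y\<in>carrier complex_field. y \<oplus>\<^bsub>complex_field\<^esub> x = \<zero>\<^bsub>complex_field\<^esub>"
      by (rule bexI[of _ "- x"]) auto
  qed (auto simp: algebra_simps)
next
  fix a assume "a \<noteq> \<zero>\<^bsub>complex_field\<^esub>"
  then show "\<exists>b\<in>carrier complex_field. a \<otimes>\<^bsub>complex_field\<^esub> b = \<one>\<^bsub>complex_field\<^esub>"
    by (intro bexI[of _ "inverse a"]) auto
qed auto

locale cspace = vectorspace complex_field V for V :: "(complex, 'v) module" (structure)
begin

lemma smult_in [simp, intro]: "x \<in> carrier V \<Longrightarrow> a \<odot> x \<in> carrier V"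
  by simp

lemma smult_add_left: "x \<in> carrier V \<Longrightarrow> (a + b) \<odot> x = a \<odot> x \<oplus> b \<odot> x"
  using smult_l_distr[of a b x] by simp

lemma smult_add_right: "x \<in> carrier V \<Longrightarrow> y \<in> carrier V \<Longrightarrow> a \<odot> (x \<oplus> y) = a \<odot> x \<oplus> a \<odot> y"
  by (rule smult_r_distr) simp_all

lemma smult_smult: "x \<in> carrier V \<Longrightarrow> a \<odot> (b \<odot> x) = (a * b) \<odot> x"
  using smult_assoc1[of a b x] by simp

lemma smult_1 [simp]: "x \<in> carrier V \<Longrightarrow> 1 \<odot> x = x"
  using smult_one by simp

lemma smult_0 [simp]: "x \<in> carrier V \<Longrightarrow> 0 \<odot> x = \<zero>"
  using smult_l_null by simp

lemma smult_neg1: "x \<in> carrier V \<Longrightarrow> \<ominus> x = (- 1) \<odot> x"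
proof -
  assume x: "x \<in> carrier V"
  have "(- 1) \<odot> x \<oplus> x = (- 1 + 1) \<odot> x"
    using x by (subst smult_add_left) auto
  also have "\<dots> = \<zero>" using x by simp
  finally show ?thesis using x by (metis minus_equality smult_in)
qed

lemma submoduleI':
  assumes "N \<subseteq> carrier V" "\<zero> \<in> N" "\<And>x y. x \<in> N \<Longrightarrow> y \<in> N \<Longrightarrow> x \<oplus> y \<in> N"
    "\<And>c x. x \<in> N \<Longrightarrow> c \<odot> x \<in> N"
  shows "submodule complex_field N V"
  using assms module_axioms by (unfold_locales) auto

end

lemma cspaceI:
  assumes zero: "\<zero>\<^bsub>V\<^esub> \<in> carrier V"
    and add: "\<And>v w. v \<in> carrier V \<Longrightarrow> w \<in> carrier V \<Longrightarrow> v \<oplus>\<^bsub>V\<^esub> w \<in> carrier V"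
    and smult: "\<And>c v. v \<in> carrier V \<Longrightarrow> c \<odot>\<^bsub>V\<^esub> v \<in> carrier V"
    and comm: "\<And>v w. v \<in> carrier V \<Longrightarrow> w \<in> carrier V \<Longrightarrow> v \<oplus>\<^bsub>V\<^esub> w = w \<oplus>\<^bsub>V\<^esub> v"
    and assoc: "\<And>v w x. v \<in> carrier V \<Longrightarrow> w \<in> carrier V \<Longrightarrow> x \<in> carrier V \<Longrightarrow>
      (v \<oplus>\<^bsub>V\<^esub> w) \<oplus>\<^bsub>V\<^esub> x = v \<oplus>\<^bsub>V\<^esub> (w \<oplus>\<^bsub>V\<^esub> x)"
    and add_zero: "\<And>v. v \<in> carrier V \<Longrightarrow> v \<oplus>\<^bsub>V\<^esub> \<zero>\<^bsub>V\<^esub> = v"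
    and smult_0: "\<And>v. v \<in> carrier V \<Longrightarrow> 0 \<odot>\<^bsub>V\<^esub> v = \<zero>\<^bsub>V\<^esub>"
    and smult_smult: "\<And>a b v. v \<in> carrier V \<Longrightarrow> (a * b) \<odot>\<^bsub>V\<^esub> v = a \<odot>\<^bsub>V\<^esub> (b \<odot>\<^bsub>V\<^esub> v)"
    and smult_1: "\<And>v. v \<in> carrier V \<Longrightarrow> 1 \<odot>\<^bsub>V\<^esub> v = v"
    and add_smult: "\<And>a b v. v \<in> carrier V \<Longrightarrow> (a + b) \<odot>\<^bsub>V\<^esub> v = a \<odot>\<^bsub>V\<^esub> v \<oplus>\<^bsub>V\<^esub> b \<odot>\<^bsub>V\<^esub> v"
    and smult_add: "\<And>a v w. v \<in> carrier V \<Longrightarrow> w \<in> carrier V \<Longrightarrow>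
      a \<odot>\<^bsub>V\<^esub> (v \<oplus>\<^bsub>V\<^esub> w) = a \<odot>\<^bsub>V\<^esub> v \<oplus>\<^bsub>V\<^esub> a \<odot>\<^bsub>V\<^esub> w"
  shows "cspace V"
proof -
  have neg: "\<exists>w\<in>carrier V. v \<oplus>\<^bsub>V\<^esub> w = \<zero>\<^bsub>V\<^esub>" if v: "v \<in> carrier V" for v
  proof (rule bexI[of _ "(- 1) \<odot>\<^bsub>V\<^esub> v"])
    have "v \<oplus>\<^bsub>V\<^esub> (- 1) \<odot>\<^bsub>V\<^esub> v = (1 + (- 1)) \<odot>\<^bsub>V\<^esub> v"
      using v by (simp only: add_smult smult_1)
    then show "v \<oplus>\<^bsub>V\<^esub> (- 1) \<odot>\<^bsub>V\<^esub> v = \<zero>\<^bsub>V\<^esub>"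
      using v smult_0 by simp
  qed (use v smult in auto)
  show ?thesis
    unfolding cspace_def
    by (rule vs_criteria[OF field_complex_field])
       (use assms neg in \<open>auto simp: add_smult smult_add smult_smult\<close>)
qed

abbreviation linear_maps ::
  "(complex, 'v) module \<Rightarrow> (complex, 'w) module \<Rightarrow> ('v \<Rightarrow> 'w) set" where
  "linear_maps \<equiv> module_hom complex_field"

lemma linear_mapsI:
  assumes "\<And>x. x \<in> carrier V \<Longrightarrow> f x \<in> carrier W"
    "\<And>x y. x \<in> carrier V \<Longrightarrow> y \<in> carrier V \<Longrightarrow> f (x \<oplus>\<^bsub>V\<^esub> y) = f x \<oplus>\<^bsub>W\<^esub> f y"
    "\<And>c x. x \<in> carrier V \<Longrightarrow> f (c \<odot>\<^bsub>V\<^esub> x) = c \<odot>\<^bsub>W\<^esub> f x"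
  shows "f \<in> linear_maps V W"
  using assms by (auto simp: module_hom_def)

lemma
  assumes "f \<in> linear_maps V W"
  shows linear_map_in: "x \<in> carrier V \<Longrightarrow> f x \<in> carrier W"
    and linear_map_add: "x \<in> carrier V \<Longrightarrow> y \<in> carrier V \<Longrightarrow> f (x \<oplus>\<^bsub>V\<^esub> y) = f x \<oplus>\<^bsub>W\<^esub> f y"
    and linear_map_smult: "x \<in> carrier V \<Longrightarrow> f (c \<odot>\<^bsub>V\<^esub> x) = c \<odot>\<^bsub>W\<^esub> f x"
  using assms by (auto simp: module_hom_def)

lemma linear_map_zero:
  assumes "cspace V" "cspace W" "f \<in> linear_maps V W"
  shows "f \<zero>\<^bsub>V\<^esub> = \<zero>\<^bsub>W\<^esub>"
proof -
  interpret V: cspace V by fact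
  interpret W: cspace W by fact
  have "f (0 \<odot>\<^bsub>V\<^esub> \<zero>\<^bsub>V\<^esub>) = 0 \<odot>\<^bsub>W\<^esub> f \<zero>\<^bsub>V\<^esub>"
    by (rule linear_map_smult[OF assms(3)]) simp
  then show ?thesis using linear_map_in[OF assms(3)] by simp
qed

text \<open>
  The device behind all induction over spans below: to show that every vector of a spanned space has
  a property, show that the property is the preimage of a subspace under a linear map.
\<close>

lemma (in cspace) preimage_submodule:
  assumes "cspace W" "f \<in> linear_maps V W" "submodule complex_field U W"
  shows "submodule complex_field {x \<in> carrier V. f x \<in> U} V"
proof -
  interpret W: cspace W by fact
  interpret U: submodule complex_field U W by fact
  show ?thesis
    by (rule submoduleI')
       (use linear_map_zero[OF cspace_axioms assms(1,2)] in
         \<open>auto simp: linear_map_add[OF assms(2)] linear_map_smult[OF assms(2)]\<close>)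
qed

section \<open>Quotients\<close>

locale csubspace = cspace V + submodule complex_field N V
  for V :: "(complex, 'v) module" (structure) and N
begin

lemma minus_in: "x \<in> N \<Longrightarrow> \<ominus> x \<in> N"
  using smult_neg1 subset by auto

lemma additive_subgroup: "additive_subgroup N V"
  by (rule additive_subgroupI, rule subgroup.intro)
     (use subset minus_in in \<open>auto simp: a_inv_def[symmetric]\<close>)

sublocale S: abelian_subgroup N V
  by (rule abelian_subgroupI3[OF additive_subgroup]) (rule M.abelian_group_axioms)

lemma coset_eqI:
  assumes "x \<in> carrier V" "n \<in> N" "y = n \<oplus> x"
  shows "N +> y = N +> x"
  using S.a_repr_independence'[of y x] assms by (auto simp: a_r_coset_def')

abbreviation Q where "Q \<equiv> quot_module V N"

lemma carrier_quot: "carrier Q = (\<lambda>x. N +> x) ` carrier V"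
  by (auto simp: quot_module_def FactRing_simps ring.defs module.defs A_RCOSETS_def')

text \<open>
  Invariance of \<open>N\<close> makes all representatives of a coset contribute the same coset to the union that
  defines \<open>quot_map\<close>. Scalar multiplication on the quotient is the case of a homothety.
\<close>

lemma quot_map_coset:
  assumes T: "T \<in> linear_maps V V" "\<And>x. x \<in> N \<Longrightarrow> T x \<in> N" and x: "x \<in> carrier V"
  shows "quot_map V N T (N +> x) = N +> T x"
proof -
  have "N +> T y = N +> T x" if "y \<in> N +> x" for y
  proof -
    from that obtain n where n: "n \<in> N" "y = n \<oplus> x" by (auto simp: a_r_coset_def')
    then have "T y = T n \<oplus> T x" using T x subset by (auto simp: linear_map_add[OF T(1)])
    then show ?thesis using T n x by (intro coset_eqI) (auto simp: linear_map_in[OF T(1)])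
  qed
  moreover have "N +> x \<noteq> {}" using S.a_rcos_self[OF x] by blast
  ultimately show ?thesis unfolding quot_map_def by (intro SUP_eq_const)
qed

lemma smult_linear: "(\<lambda>x. c \<odot> x) \<in> linear_maps V V"
  by (rule linear_mapsI) (auto simp: smult_add_right smult_smult mult.commute)

lemma quot_zero: "\<zero>\<^bsub>Q\<^esub> = N +> \<zero>"
  using subset by (simp add: quot_module_def FactRing_def ring.defs module.defs)

lemma quot_add: "x \<in> carrier V \<Longrightarrow> y \<in> carrier V \<Longrightarrow> (N +> x) \<oplus>\<^bsub>Q\<^esub> (N +> y) = N +> (x \<oplus> y)"
  using S.a_rcos_sum by (simp add: quot_module_def FactRing_def ring.defs module.defs)

lemma quot_smult: "x \<in> carrier V \<Longrightarrow> c \<odot>\<^bsub>Q\<^esub> (N +> x) = N +> (c \<odot> x)"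
  using quot_map_coset[OF smult_linear[of c]]
  by (simp add: quot_module_def ring.defs module.defs quot_map_def)

lemma cspace_quot: "cspace Q"
  by (rule cspaceI)
     (auto simp: carrier_quot quot_zero quot_add quot_smult smult_add_left smult_add_right
        smult_smult a_ac)

lemma coset_linear: "(\<lambda>x. N +> x) \<in> linear_maps V Q"
  by (rule linear_mapsI) (auto simp: carrier_quot quot_add quot_smult)

lemma quot_map_linear:
  assumes T: "T \<in> linear_maps V V" "\<And>x. x \<in> N \<Longrightarrow> T x \<in> N"
  shows "quot_map V N T \<in> linear_maps Q Q"
  by (rule linear_mapsI)
     (auto simp: carrier_quot quot_add quot_smult quot_map_coset[OF T] linear_map_in[OF T(1)]
        linear_map_add[OF T(1)] linear_map_smult[OF T(1)])

end

section \<open>Eigenspaces of an operator with a spanning set of eigenvectors\<close>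

text \<open>
  Call a vector good if some product of operators \<open>T - l\<close> with \<open>l \<noteq> \<mu>\<close> carries it into the line
  \<open>L\<close> of the one spanning eigenvector with eigenvalue \<open>\<mu>\<close>. These operators commute and preserve \<open>L\<close>, so
  the good vectors form a subspace. It contains all spanning eigenvectors, hence everything. But on
  an eigenvector for \<open>\<mu>\<close> such a product is multiplication by a nonzero scalar, so that the
  eigenvector was in \<open>L\<close> already.
\<close>

lemma (in cspace) eigenspace_in_line:
  fixes E :: "'k \<Rightarrow> 'v" and wt :: "'k \<Rightarrow> complex"
  assumes T: "T \<in> linear_maps V V"
    and E: "\<And>k. E k \<in> carrier V" "\<And>k. T (E k) = wt k \<odot> E k"
    and inj: "inj wt" and gen: "span (range E) = carrier V"
  shows "\<exists>e\<in>carrier V. \<forall>w\<in>carrier V. T w = \<mu> \<odot> w \<longrightarrow> (\<exists>c. w = c \<odot> e)"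
proof -
  note T_simps [simp] = linear_map_in[OF T] linear_map_add[OF T] linear_map_smult[OF T]
  obtain e where e [simp]: "e \<in> carrier V" "T e = \<mu> \<odot> e" and e_E: "\<And>k. wt k = \<mu> \<Longrightarrow> E k = e"
  proof (cases "\<exists>k. wt k = \<mu>")
    case True
    then obtain k where "wt k = \<mu>" by blast
    then show ?thesis using that[of "E k"] E inj by (metis injD)
  next
    case False
    \<comment> \<open>Without a spanning eigenvector for \<open>\<mu>\<close> the line degenerates to the zero space.\<close>
    then show ?thesis
      using that[of \<zero>] linear_map_zero[OF cspace_axioms cspace_axioms T] by auto
  qed
  define L where "L = {c \<odot> e | c. True}"
  define D where "D = (\<lambda>l w. T w \<oplus> (- l) \<odot> w)"
  have L: "submodule complex_field L V"
    by (rule submoduleI')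
       (auto simp: L_def smult_smult smult_add_left[symmetric] intro: exI[of _ 0])
  interpret L: submodule complex_field L V by (rule L)
  have D_linear: "D l \<in> linear_maps V V" for l
    by (rule linear_mapsI) (auto simp: D_def smult_add_right smult_smult a_ac mult.commute)
  have D_commute: "D l (D m w) = D m (D l w)" if "w \<in> carrier V" for l m w
    using that by (simp add: D_def smult_add_right smult_smult a_ac mult.commute)
  have D_L: "D l w \<in> L" if "w \<in> L" for l w
    using that by (auto simp: L_def D_def smult_smult smult_add_left[symmetric])
  have P_linear: "fold D ls \<in> linear_maps V V" for ls
  proof (induction ls)
    case Nil
    then show ?case by (simp add: module_hom_def)
  next
    case (Cons l ls)
    then show ?case using D_linear[of l] by (auto simp: module_hom_def Pi_def)
  qed
  note P_in = linear_map_in[OF P_linear]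
  have P_L: "fold D ls w \<in> L" if "w \<in> L" for ls w
    using that by (induction ls arbitrary: w) (auto simp: D_L)
  have DP: "D l (fold D ls w) = fold D ls (D l w)" if "w \<in> carrier V" for l ls w
    using that linear_map_in[OF D_linear] by (induction ls arbitrary: w) (auto simp: D_commute)
  have PP: "fold D as (fold D bs w) = fold D bs (fold D as w)" if "w \<in> carrier V" for as bs w
    using that linear_map_in[OF D_linear] by (induction as arbitrary: w) (auto simp: DP)
  define U where "U = {w \<in> carrier V. \<exists>ls. \<mu> \<notin> set ls \<and> fold D ls w \<in> L}"
  have "submodule complex_field U V"
  proof (rule submoduleI')
    show "\<zero> \<in> U" by (auto simp: U_def intro: exI[of _ "[]"])
  next
    fix x y assume "x \<in> U" "y \<in> U"
    then obtain as bs where x: "x \<in> carrier V" "\<mu> \<notin> set as" "fold D as x \<in> L"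
      and y: "y \<in> carrier V" "\<mu> \<notin> set bs" "fold D bs y \<in> L"
      by (auto simp: U_def)
    have "fold D (as @ bs) (x \<oplus> y) = fold D bs (fold D as x) \<oplus> fold D as (fold D bs y)"
      using x y by (simp only: linear_map_add[OF P_linear] P_in fold_append comp_apply PP)
    also have "\<dots> \<in> L" using x y P_L by auto
    finally show "x \<oplus> y \<in> U"
      using x y unfolding U_def by (auto intro!: exI[of _ "as @ bs"])
  next
    fix c x assume "x \<in> U"
    then show "c \<odot> x \<in> U" by (auto simp: U_def linear_map_smult[OF P_linear])
  qed (auto simp: U_def)
  moreover have "E k \<in> U" for k
  proof (cases "wt k = \<mu>")
    case True
    then have "E k \<in> L" using e_E e by (auto simp: L_def intro!: exI[of _ 1])
    then show ?thesis using E by (auto simp: U_def intro!: exI[of _ "[]"])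
  next
    case False
    have "D (wt k) (E k) = \<zero>"
      using E by (simp add: D_def smult_add_left[symmetric])
    then show ?thesis using E False by (auto simp: U_def intro!: exI[of _ "[wt k]"])
  qed
  ultimately have U: "carrier V \<subseteq> U" using span_is_subset[of "range E" U] gen by auto
  show ?thesis
  proof (intro bexI ballI impI)
    fix w assume w: "w \<in> carrier V" "T w = \<mu> \<odot> w"
    then obtain ls where ls: "\<mu> \<notin> set ls" "fold D ls w \<in> L" using U by (auto simp: U_def)
    have "fold D as w = prod_list (map (\<lambda>l. \<mu> - l) as) \<odot> w" for as
    proof (induction as)
      case (Cons l as)
      have "D l w = (\<mu> - l) \<odot> w" using w by (simp add: D_def smult_add_left[symmetric])
      then show ?case
        using Cons w by (simp add: linear_map_smult[OF P_linear] smult_smult mult.commute)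
    qed (use w in simp)
    then have "prod_list (map (\<lambda>l. \<mu> - l) ls) \<odot> w \<in> L" using ls(2) by simp
    moreover have "prod_list (map (\<lambda>l. \<mu> - l) ls) \<noteq> 0" using ls(1) by (induction ls) auto
    ultimately obtain r c where r: "r \<noteq> 0" "r \<odot> w = c \<odot> e" unfolding L_def by blast
    have "w = (inverse r * r) \<odot> w" using r w by simp
    also have "\<dots> = inverse r \<odot> (c \<odot> e)" using r w by (simp only: smult_smult[symmetric])
    also have "\<dots> = (inverse r * c) \<odot> e" by (simp add: smult_smult)
    finally show "\<exists>c. w = c \<odot> e" by blast
  qed simp
qed

section \<open>Intertwining operators from the complex line\<close>

text \<open>
  A generating vector, possibly zero, bounds the dimension; it also shows that the space has finite
  dimension, so that \<open>vs_dim\<close> is not the default value \<open>\<infinity>\<close>.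
\<close>

lemma (in cspace) vs_dim_le_1:
  assumes f: "f \<in> carrier V" and gen: "\<And>g. g \<in> carrier V \<Longrightarrow> \<exists>c. g = c \<odot> f"
  shows "vs_dim V \<le> 1"
proof -
  have "submodule complex_field (span {f}) V" using f by (intro span_is_submodule) simp
  then interpret S: submodule complex_field "span {f}" V .
  have "f \<in> span {f}" using in_own_span[of "{f}"] f by simp
  then have "c \<odot> f \<in> span {f}" for c using S.smult_closed by simp
  then have "carrier V \<subseteq> span {f}" using gen by (metis subsetI)
  then have g: "span {f} = carrier V" using S.subset by blast
  have "fin_dim" unfolding fin_dim_def using f g by (intro exI[of _ "{f}"]) auto
  moreover have "dim \<le> 1" using gen_ge_dim[of "{f}"] f g by simp
  ultimately show ?thesis by (simp add: vs_dim_def one_enat_def)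
qed

lemma complex_line_simps [simp]:
  "carrier complex_line = UNIV" "(\<oplus>\<^bsub>complex_line\<^esub>) = (+)" "\<zero>\<^bsub>complex_line\<^esub> = 0"
  "(\<odot>\<^bsub>complex_line\<^esub>) = (*)"
  by (simp_all add: complex_line_def complex_field_def ring.defs module.defs)

lemma cspace_complex_line: "cspace complex_line"
  by (rule cspaceI) (auto simp: algebra_simps)

lemma hom_space_simps [simp]:
  "\<zero>\<^bsub>hom_space h V \<rho> W \<sigma>\<^esub> = (\<lambda>x\<in>carrier V. \<zero>\<^bsub>W\<^esub>)"
  "f \<oplus>\<^bsub>hom_space h V \<rho> W \<sigma>\<^esub> g = (\<lambda>x\<in>carrier V. f x \<oplus>\<^bsub>W\<^esub> g x)"
  "c \<odot>\<^bsub>hom_space h V \<rho> W \<sigma>\<^esub> f = (\<lambda>x\<in>carrier V. c \<odot>\<^bsub>W\<^esub> f x)"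
  by (simp_all add: hom_space_def)

lemma carrier_hom_space:
  "f \<in> carrier (hom_space h V \<rho> W \<sigma>) \<longleftrightarrow> f \<in> linear_maps V W \<and> f \<in> extensional (carrier V) \<and>
     (\<forall>H\<in>h. \<forall>x\<in>carrier V. f (\<rho> H x) = \<sigma> H (f x))"
  by (auto simp: hom_space_def)

text \<open>
  Linearity of the \<open>\<sigma> H\<close> makes the intertwining condition a linear one. The \<open>\<rho> H\<close> have to preserve
  the carrier because extensional maps, and with them their sums, are \<open>undefined\<close> outside of it.
\<close>

lemma cspace_hom_space:
  assumes "cspace V" "cspace W"
    and \<rho>: "\<And>H x. H \<in> h \<Longrightarrow> x \<in> carrier V \<Longrightarrow> \<rho> H x \<in> carrier V"
    and \<sigma>: "\<And>H. H \<in> h \<Longrightarrow> \<sigma> H \<in> linear_maps W W"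
  shows "cspace (hom_space h V \<rho> W \<sigma>)"
proof -
  interpret V: cspace V by fact
  interpret W: cspace W by fact
  let ?H = "hom_space h V \<rho> W \<sigma>"
  have val: "f x \<in> carrier W" if "f \<in> carrier ?H" "x \<in> carrier V" for f x
    using that by (auto simp: carrier_hom_space intro: linear_map_in)
  have ext: "f = g" if "f \<in> extensional (carrier V)" "g \<in> extensional (carrier V)"
    "\<And>x. x \<in> carrier V \<Longrightarrow> f x = g x" for f g :: "'a \<Rightarrow> 'b"
    using that by (rule extensionalityI)
  have e: "f \<in> extensional (carrier V)" if "f \<in> carrier ?H" for f
    using that by (simp add: carrier_hom_space)
  show ?thesis
  proof (rule cspaceI)
    show "\<zero>\<^bsub>?H\<^esub> \<in> carrier ?H"
      by (auto simp: carrier_hom_space \<rho> linear_map_zero[OF assms(2,2) \<sigma>] intro!: linear_mapsI)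
  next
    fix f g assume fg: "f \<in> carrier ?H" "g \<in> carrier ?H"
    note v = val[OF fg(1)] val[OF fg(2)]
    from fg have l: "f \<in> linear_maps V W" "g \<in> linear_maps V W" by (auto simp: carrier_hom_space)
    have "(\<lambda>x\<in>carrier V. f x \<oplus>\<^bsub>W\<^esub> g x) \<in> linear_maps V W"
      by (rule linear_mapsI)
         (auto simp: v linear_map_add[OF l(1)] linear_map_add[OF l(2)] linear_map_smult[OF l(1)]
           linear_map_smult[OF l(2)] W.a_ac W.smult_add_right)
    then show "f \<oplus>\<^bsub>?H\<^esub> g \<in> carrier ?H"
      using fg by (auto simp: carrier_hom_space \<rho> v linear_map_add[OF \<sigma>])
  next
    fix c f assume f: "f \<in> carrier ?H"
    note v = val[OF f]
    from f have l: "f \<in> linear_maps V W" by (auto simp: carrier_hom_space)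
    have "(\<lambda>x\<in>carrier V. c \<odot>\<^bsub>W\<^esub> f x) \<in> linear_maps V W"
      by (rule linear_mapsI)
         (auto simp: v linear_map_add[OF l] linear_map_smult[OF l] W.smult_add_right
           W.smult_smult mult.commute)
    then show "c \<odot>\<^bsub>?H\<^esub> f \<in> carrier ?H"
      using f by (auto simp: carrier_hom_space \<rho> v linear_map_smult[OF \<sigma>])
  qed (auto intro!: ext restrict_extensional intro: e simp: val W.a_ac W.smult_add_left W.smult_add_right W.smult_smult)
qed

text \<open>
  An intertwining operator \<open>f\<close> from the line with character \<open>\<mu>\<close> is determined by \<open>f 1\<close>, a simultaneous
  eigenvector. If all of these are multiples of one vector, then all operators are multiples of
  any one that does not vanish at \<open>1\<close>.
\<close>

lemma vs_dim_hom_complex_line_le_1: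
  assumes "cspace W"
    and \<sigma>: "\<And>H. H \<in> h \<Longrightarrow> \<sigma> H \<in> linear_maps W W"
    and e: "e \<in> carrier W"
    and line: "\<And>w. w \<in> carrier W \<Longrightarrow> (\<forall>H\<in>h. \<sigma> H w = \<mu> H \<odot>\<^bsub>W\<^esub> w) \<Longrightarrow> \<exists>c. w = c \<odot>\<^bsub>W\<^esub> e"
  shows "vs_dim (hom_space h complex_line (\<lambda>H z. \<mu> H * z) W \<sigma>) \<le> 1"
proof -
  interpret W: cspace W by fact
  let ?H = "hom_space h complex_line (\<lambda>H z. \<mu> H * z) W \<sigma>"
  interpret H: cspace ?H
    by (rule cspace_hom_space[OF cspace_complex_line assms(1)]) (use \<sigma> in auto)
  have val: "f z = z \<odot>\<^bsub>W\<^esub> f 1" if "f \<in> carrier ?H" for f z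
    using linear_map_smult[of f complex_line W 1 z] that by (simp add: carrier_hom_space)
  have val_in: "f 1 \<in> carrier W" if "f \<in> carrier ?H" for f
    using linear_map_in[of f complex_line W 1] that by (simp add: carrier_hom_space)
  have val_e: "\<exists>c. f 1 = c \<odot>\<^bsub>W\<^esub> e" if f: "f \<in> carrier ?H" for f
  proof (rule line)
    have "\<sigma> H (f 1) = \<mu> H \<odot>\<^bsub>W\<^esub> f 1" if "H \<in> h" for H
    proof -
      have "f (\<mu> H * 1) = \<sigma> H (f 1)"
        using f that unfolding carrier_hom_space complex_line_simps by blast
      then have "\<sigma> H (f 1) = f (\<mu> H)" by simp
      also have "\<dots> = \<mu> H \<odot>\<^bsub>W\<^esub> f 1" by (rule val[OF f])
      finally show ?thesis .
    qed
    then show "\<forall>H\<in>h. \<sigma> H (f 1) = \<mu> H \<odot>\<^bsub>W\<^esub> f 1" by blast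
  qed (rule val_in[OF f])
  have eq: "f = c \<odot>\<^bsub>?H\<^esub> g"
    if "f \<in> carrier ?H" "g \<in> carrier ?H" "f 1 = c \<odot>\<^bsub>W\<^esub> g 1" for f g c
  proof
    fix z
    have "f z = z \<odot>\<^bsub>W\<^esub> (c \<odot>\<^bsub>W\<^esub> g 1)" using val[OF that(1), of z] that(3) by (simp only:)
    also have "\<dots> = c \<odot>\<^bsub>W\<^esub> (z \<odot>\<^bsub>W\<^esub> g 1)"
      using val_in[OF that(2)] by (simp add: W.smult_smult mult.commute)
    also have "\<dots> = (c \<odot>\<^bsub>?H\<^esub> g) z" using val[OF that(2), of z] by simp
    finally show "f z = (c \<odot>\<^bsub>?H\<^esub> g) z" .
  qed
  show ?thesis
  proof (cases "\<exists>f\<in>carrier ?H. f 1 \<noteq> \<zero>\<^bsub>W\<^esub>")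
    case True
    then obtain f where f: "f \<in> carrier ?H" "f 1 \<noteq> \<zero>\<^bsub>W\<^esub>" by blast
    obtain a where a: "f 1 = a \<odot>\<^bsub>W\<^esub> e" using val_e f by blast
    then have "a \<noteq> 0" using f e by auto
    show ?thesis
    proof (rule H.vs_dim_le_1[OF f(1)])
      fix g assume g: "g \<in> carrier ?H"
      obtain b where "g 1 = b \<odot>\<^bsub>W\<^esub> e" using val_e g by blast
      then have "g 1 = (b / a) \<odot>\<^bsub>W\<^esub> f 1" using a e \<open>a \<noteq> 0\<close> by (simp add: W.smult_smult)
      then show "\<exists>c. g = c \<odot>\<^bsub>?H\<^esub> f" using eq[OF g f(1)] by blast
    qed
  next
    case False
    show ?thesis
    proof (rule H.vs_dim_le_1[OF H.zero_closed])
      fix g assume g: "g \<in> carrier ?H"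
      then have "g 1 = \<zero>\<^bsub>W\<^esub>" using False by blast
      then have "g 1 = 1 \<odot>\<^bsub>W\<^esub> \<zero>\<^bsub>?H\<^esub> 1" by simp
      then show "\<exists>c. g = c \<odot>\<^bsub>?H\<^esub> \<zero>\<^bsub>?H\<^esub>" using eq[OF g H.zero_closed] by blast
    qed
  qed
qed

section \<open>Spaces of finitely supported functions\<close>

definition pm_scale :: "complex \<Rightarrow> ('b \<Rightarrow>\<^sub>0 complex) \<Rightarrow> 'b \<Rightarrow>\<^sub>0 complex" where
  "pm_scale c = Poly_Mapping.map ((*) c)"

lemma lookup_scale [simp]: "Poly_Mapping.lookup (pm_scale c p) k = c * Poly_Mapping.lookup p k"
  by (simp add: pm_scale_def Poly_Mapping.map.rep_eq when_def)

lemma pm_scale_single [simp]: "pm_scale c (Poly_Mapping.single k d) = Poly_Mapping.single k (c * d)"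
  by (rule poly_mapping_eqI) (simp add: lookup_single when_def)

lemma pm_scale_add_right: "pm_scale c (p + q) = pm_scale c p + pm_scale c q"
  by (rule poly_mapping_eqI) (simp add: lookup_add algebra_simps)

lemma pm_scale_add_left: "pm_scale (c + d) p = pm_scale c p + pm_scale d p"
  by (rule poly_mapping_eqI) (simp add: lookup_add algebra_simps)

lemma pm_scale_scale: "pm_scale c (pm_scale d p) = pm_scale (c * d) p"
  by (rule poly_mapping_eqI) simp

lemma pm_scale_0 [simp]: "pm_scale 0 p = 0"
  by (rule poly_mapping_eqI) simp

lemma pm_scale_0_right [simp]: "pm_scale c 0 = 0"
  by (rule poly_mapping_eqI) simp

lemma pm_scale_1 [simp]: "pm_scale 1 p = p"
  by (rule poly_mapping_eqI) simp

text \<open>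
  The linear map with prescribed values \<open>d k\<close> at the basis vectors \<open>k\<close>. It is linear on the whole
  type, so that computations with relations can be done by ordinary rewriting.
\<close>

definition linear_extension :: "('b \<Rightarrow> 'c \<Rightarrow>\<^sub>0 complex) \<Rightarrow> ('b \<Rightarrow>\<^sub>0 complex) \<Rightarrow> 'c \<Rightarrow>\<^sub>0 complex" where
  "linear_extension d p =
     (\<Sum>k\<in>Poly_Mapping.keys p. pm_scale (Poly_Mapping.lookup p k) (d k))"

lemma linear_extension_single [simp]:
  "linear_extension d (Poly_Mapping.single k c) = pm_scale c (d k)"
  by (cases "c = 0") (simp_all add: linear_extension_def)

lemma linear_extension_add:
  "linear_extension d (p + q) = linear_extension d p + linear_extension d q"
  unfolding linear_extension_def by (rule setsum_keys_plus_distrib) (simp_all add: pm_scale_add_left)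

lemma linear_extension_diff:
  "linear_extension d (p - q) = linear_extension d p - linear_extension d q"
  using linear_extension_add[of d "p - q" q] by simp

lemma pm_scale_sum: "pm_scale c (sum f A) = (\<Sum>a\<in>A. pm_scale c (f a))"
  by (rule poly_mapping_eqI) (simp add: lookup_sum sum_distrib_left)

lemma linear_extension_scale: "linear_extension d (pm_scale c p) = pm_scale c (linear_extension d p)"
proof (cases "c = 0")
  case True
  then show ?thesis by (simp add: linear_extension_def)
next
  case False
  then have "Poly_Mapping.keys (pm_scale c p) = Poly_Mapping.keys p"
    by (auto simp: in_keys_iff)
  then show ?thesis by (simp add: linear_extension_def pm_scale_sum pm_scale_scale)
qed

lemma poly_mapping_sum_single:
  "(\<Sum>k\<in>Poly_Mapping.keys p. Poly_Mapping.single k (Poly_Mapping.lookup p k)) = p"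
  by (rule poly_mapping_eqI) (simp add: lookup_sum lookup_single when_def in_keys_iff)

text \<open>
  As vector spaces, the free space on a set and the polynomial algebra are both of this form; their
  products differ.
\<close>

locale coeff_space =
  fixes M :: "(complex, 'b \<Rightarrow>\<^sub>0 complex) module" (structure) and B :: "'b set"
  assumes carrier_eq: "carrier M = {p. Poly_Mapping.keys p \<subseteq> B}"
    and zero_eq [simp]: "\<zero> = 0"
    and add_eq [simp]: "p \<oplus> q = p + q"
    and smult_eq [simp]: "c \<odot> p = pm_scale c p"
begin

lemma add_in: "p \<in> carrier M \<Longrightarrow> q \<in> carrier M \<Longrightarrow> p + q \<in> carrier M"
  using keys_add[of p q] by (auto simp: carrier_eq)

lemma pm_scale_in: "p \<in> carrier M \<Longrightarrow> pm_scale c p \<in> carrier M"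
  by (auto simp: carrier_eq in_keys_iff)

lemma single_in: "k \<in> B \<Longrightarrow> Poly_Mapping.single k c \<in> carrier M"
  by (auto simp: carrier_eq)

lemma diff_in: "p \<in> carrier M \<Longrightarrow> q \<in> carrier M \<Longrightarrow> p - q \<in> carrier M"
  using keys_diff[of p q] by (auto simp: carrier_eq)

lemma cspace: "cspace M"
  by (rule cspaceI)
     (auto simp: add_in pm_scale_in pm_scale_scale pm_scale_add_left pm_scale_add_right algebra_simps,
      simp add: carrier_eq)

sublocale cspace M by (rule cspace)

lemma sum_in_submodule:
  assumes "submodule complex_field U M" "finite A" "\<And>a. a \<in> A \<Longrightarrow> f a \<in> U"
  shows "sum f A \<in> U"
proof -
  interpret U: submodule complex_field U M by fact
  show ?thesis
    using assms(2,3) U.zero_closed U.m_closed by (induction A) auto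
qed

lemma submodule_carrier: "submodule complex_field (carrier M) M"
  by (rule submoduleI') (use zero_closed in \<open>auto simp: add_in pm_scale_in\<close>)

lemma submodule_full:
  assumes U: "submodule complex_field U M"
    and single: "\<And>k. k \<in> B \<Longrightarrow> Poly_Mapping.single k 1 \<in> U"
  shows "U = carrier M"
proof
  interpret U: submodule complex_field U M by fact
  show "U \<subseteq> carrier M" by (rule U.subset)
  show "carrier M \<subseteq> U"
  proof
    fix p assume "p \<in> carrier M"
    then have "Poly_Mapping.single k (Poly_Mapping.lookup p k) \<in> U"
      if "k \<in> Poly_Mapping.keys p" for k
      using U.smult_closed[OF _ single[of k], of "Poly_Mapping.lookup p k"] that
      by (auto simp: carrier_eq)
    then have "(\<Sum>k\<in>Poly_Mapping.keys p. Poly_Mapping.single k (Poly_Mapping.lookup p k)) \<in> U"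
      by (intro sum_in_submodule[OF U]) auto
    then show "p \<in> U" by (simp add: poly_mapping_sum_single)
  qed
qed

lemma linear_extension_linear:
  assumes "\<And>k. k \<in> B \<Longrightarrow> d k \<in> carrier M"
  shows "linear_extension d \<in> linear_maps M M"
proof (rule linear_mapsI)
  fix p assume p: "p \<in> carrier M"
  show "linear_extension d p \<in> carrier M"
    unfolding linear_extension_def
  proof (rule sum_in_submodule[OF submodule_carrier])
    fix k assume "k \<in> Poly_Mapping.keys p"
    then have "k \<in> B" using p by (auto simp: carrier_eq)
    then show "pm_scale (Poly_Mapping.lookup p k) (d k) \<in> carrier M" using assms by (intro pm_scale_in)
  qed simp
qed (auto simp: linear_extension_add linear_extension_scale)

end

text \<open>
  With ordinary subtraction available upstairs, congruence modulo \<open>N\<close> is tested by a difference.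
\<close>

locale coeff_quot = coeff_space M B + csubspace M N
  for M :: "(complex, 'b \<Rightarrow>\<^sub>0 complex) module" (structure) and B N
begin

lemma coset_eq: "p \<in> carrier M \<Longrightarrow> q - p \<in> N \<Longrightarrow> N +> q = N +> p"
  by (rule coset_eqI[where n = "q - p"]) auto

lemma quot_full:
  assumes "submodule complex_field U Q" "\<And>k. k \<in> B \<Longrightarrow> N +> Poly_Mapping.single k 1 \<in> U"
  shows "U = carrier Q"
proof
  interpret U: submodule complex_field U Q by fact
  show "U \<subseteq> carrier Q" by (rule U.subset)
  have "{p \<in> carrier M. N +> p \<in> U} = carrier M"
    by (rule submodule_full[OF preimage_submodule[OF cspace_quot coset_linear assms(1)]])
       (use assms(2) single_in in auto)
  then show "carrier Q \<subseteq> U" by (auto simp: carrier_quot)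
qed

end

section \<open>Tensor products\<close>

lemma tensor_relationsI:
  "x \<in> carrier V \<Longrightarrow> x' \<in> carrier V \<Longrightarrow> y \<in> carrier W \<Longrightarrow>
    Poly_Mapping.single (x \<oplus>\<^bsub>V\<^esub> x', y) 1 - Poly_Mapping.single (x, y) 1
      - Poly_Mapping.single (x', y) 1 \<in> tensor_relations V W"
  "x \<in> carrier V \<Longrightarrow> y \<in> carrier W \<Longrightarrow> y' \<in> carrier W \<Longrightarrow>
    Poly_Mapping.single (x, y \<oplus>\<^bsub>W\<^esub> y') 1 - Poly_Mapping.single (x, y) 1
      - Poly_Mapping.single (x, y') 1 \<in> tensor_relations V W"
  "x \<in> carrier V \<Longrightarrow> y \<in> carrier W \<Longrightarrow>
    Poly_Mapping.single (c \<odot>\<^bsub>V\<^esub> x, y) 1 - Poly_Mapping.single (x, y) c \<in> tensor_relations V W"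
  "x \<in> carrier V \<Longrightarrow> y \<in> carrier W \<Longrightarrow>
    Poly_Mapping.single (x, c \<odot>\<^bsub>W\<^esub> y) 1 - Poly_Mapping.single (x, y) c \<in> tensor_relations V W"
  unfolding tensor_relations_def by blast+

locale tensor_product = V: cspace V + W: cspace W
  for V :: "(complex, 'v) module" and W :: "(complex, 'w) module"
begin

abbreviation "F \<equiv> free_space (carrier V \<times> carrier W)"
abbreviation "K \<equiv> tensor_kernel V W"

sublocale F: coeff_space F "carrier V \<times> carrier W"
  by unfold_locales (simp_all add: free_space_def pm_scale_def)

lemma relations_in: "tensor_relations V W \<subseteq> carrier F"
  unfolding tensor_relations_def by (auto intro!: F.diff_in F.single_in)

lemma K_submodule: "submodule complex_field K F"
  unfolding tensor_kernel_def by (rule F.span_is_submodule[OF relations_in])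

sublocale T: coeff_quot F "carrier V \<times> carrier W" K
  by (intro coeff_quot.intro csubspace.intro F.coeff_space_axioms F.cspace_axioms K_submodule)

lemma relations_K: "r \<in> tensor_relations V W \<Longrightarrow> r \<in> K"
  unfolding tensor_kernel_def using F.in_own_span[OF relations_in] by blast

lemma tensor_space_eq: "tensor_space V W = T.Q"
  by (simp add: tensor_space_def)

lemma K_add: "r \<in> K \<Longrightarrow> s \<in> K \<Longrightarrow> r + s \<in> K"
  using T.m_closed by simp

definition pure :: "'v \<Rightarrow> 'w \<Rightarrow> ('v \<times> 'w \<Rightarrow>\<^sub>0 complex) set" where
  "pure x y = K +>\<^bsub>F\<^esub> Poly_Mapping.single (x, y) 1"

lemma pure_in: "x \<in> carrier V \<Longrightarrow> y \<in> carrier W \<Longrightarrow> pure x y \<in> carrier (tensor_space V W)"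
  by (simp add: pure_def tensor_space_eq T.carrier_quot F.single_in)

lemma pure_add_right:
  assumes "x \<in> carrier V" "y \<in> carrier W" "y' \<in> carrier W"
  shows "pure x (y \<oplus>\<^bsub>W\<^esub> y') = pure x y \<oplus>\<^bsub>tensor_space V W\<^esub> pure x y'"
proof -
  have "Poly_Mapping.single (x, y \<oplus>\<^bsub>W\<^esub> y') 1
      - (Poly_Mapping.single (x, y) 1 + Poly_Mapping.single (x, y') 1) \<in> tensor_relations V W"
    using tensor_relationsI(2)[OF assms] by (simp add: diff_diff_eq)
  then show ?thesis
    using assms unfolding pure_def tensor_space_eq
    by (subst T.quot_add) (auto simp: F.single_in F.add_in intro!: T.coset_eq relations_K)
qed

lemma pure_smult_left:
  assumes "x \<in> carrier V" "y \<in> carrier W"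
  shows "pure (c \<odot>\<^bsub>V\<^esub> x) y = c \<odot>\<^bsub>tensor_space V W\<^esub> pure x y"
proof -
  have "Poly_Mapping.single (c \<odot>\<^bsub>V\<^esub> x, y) 1 - Poly_Mapping.single (x, y) c \<in> tensor_relations V W"
    using assms by (rule tensor_relationsI)
  then show ?thesis
    using assms unfolding pure_def tensor_space_eq
    by (subst T.quot_smult) (auto simp: F.single_in intro!: T.coset_eq relations_K)
qed

lemma pure_smult_right:
  assumes "x \<in> carrier V" "y \<in> carrier W"
  shows "pure x (c \<odot>\<^bsub>W\<^esub> y) = c \<odot>\<^bsub>tensor_space V W\<^esub> pure x y"
proof -
  have "Poly_Mapping.single (x, c \<odot>\<^bsub>W\<^esub> y) 1 - Poly_Mapping.single (x, y) c \<in> tensor_relations V W"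
    using assms by (rule tensor_relationsI)
  then show ?thesis
    using assms unfolding pure_def tensor_space_eq
    by (subst T.quot_smult) (auto simp: F.single_in intro!: T.coset_eq relations_K)
qed

lemma pure_right_linear: "x \<in> carrier V \<Longrightarrow> pure x \<in> linear_maps W (tensor_space V W)"
  by (rule linear_mapsI) (auto simp: pure_in pure_add_right pure_smult_right)

lemma cspace_tensor: "cspace (tensor_space V W)"
  unfolding tensor_space_eq by (rule T.cspace_quot)

lemma tensor_full:
  assumes "submodule complex_field U (tensor_space V W)"
    "\<And>x y. x \<in> carrier V \<Longrightarrow> y \<in> carrier W \<Longrightarrow> pure x y \<in> U"
  shows "U = carrier (tensor_space V W)"
  using assms unfolding tensor_space_eq pure_def by (intro T.quot_full) auto

context
  fixes A B
  assumes A: "A \<in> linear_maps V V" and B: "B \<in> linear_maps W W"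
begin

abbreviation "lift_action \<equiv> linear_extension
  (\<lambda>(x, y). Poly_Mapping.single (A x, y) 1 + Poly_Mapping.single (x, B y) (1::complex))"

lemma lift_action_eq:
  "(\<lambda>p. \<Sum>(x, y)\<in>Poly_Mapping.keys p.
          Poly_Mapping.single (A x, y) (Poly_Mapping.lookup p (x, y))
          + Poly_Mapping.single (x, B y) (Poly_Mapping.lookup p (x, y))) = lift_action"
  by (rule ext) (auto simp: linear_extension_def pm_scale_add_right intro!: sum.cong)

lemma lift_action_linear: "lift_action \<in> linear_maps F F"
  by (rule F.linear_extension_linear)
     (auto intro!: F.add_in F.single_in linear_map_in[OF A] linear_map_in[OF B])

text \<open>
  By the Leibniz rule, the action turns a relation into a sum of two relations of the same kind, one
  with \<open>A\<close> applied in the first factor and one with \<open>B\<close> applied in the second.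
\<close>

lemma lift_action_relation:
  assumes "r \<in> tensor_relations V W"
  shows "lift_action r \<in> K"
proof -
  note [simp] = linear_map_in[OF A] linear_map_in[OF B] linear_map_add[OF A] linear_map_add[OF B]
    linear_map_smult[OF A] linear_map_smult[OF B]
  let ?s = "\<lambda>x y. Poly_Mapping.single (x, y) (1::complex)"
  have sum: "r \<in> K" if "r = s + t" "s \<in> tensor_relations V W" "t \<in> tensor_relations V W" for r s t
    using that relations_K K_add by auto
  consider
    (left) x x' y where "r = ?s (x \<oplus>\<^bsub>V\<^esub> x') y - ?s x y - ?s x' y"
      "x \<in> carrier V" "x' \<in> carrier V" "y \<in> carrier W"
    | (right) x y y' where "r = ?s x (y \<oplus>\<^bsub>W\<^esub> y') - ?s x y - ?s x y'"
      "x \<in> carrier V" "y \<in> carrier W" "y' \<in> carrier W"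
    | (sleft) c x y where "r = ?s (c \<odot>\<^bsub>V\<^esub> x) y - Poly_Mapping.single (x, y) c"
      "x \<in> carrier V" "y \<in> carrier W"
    | (sright) c x y where "r = ?s x (c \<odot>\<^bsub>W\<^esub> y) - Poly_Mapping.single (x, y) c"
      "x \<in> carrier V" "y \<in> carrier W"
    using assms unfolding tensor_relations_def by blast
  then show ?thesis
  proof cases
    case left
    show ?thesis
    proof (rule sum)
      show "lift_action r = (?s (A x \<oplus>\<^bsub>V\<^esub> A x') y - ?s (A x) y - ?s (A x') y)
          + (?s (x \<oplus>\<^bsub>V\<^esub> x') (B y) - ?s x (B y) - ?s x' (B y))"
        using left by (simp add: linear_extension_diff)
    qed (use left in \<open>auto intro!: tensor_relationsI\<close>)
  next
    case right
    show ?thesis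
    proof (rule sum)
      show "lift_action r = (?s (A x) (y \<oplus>\<^bsub>W\<^esub> y') - ?s (A x) y - ?s (A x) y')
          + (?s x (B y \<oplus>\<^bsub>W\<^esub> B y') - ?s x (B y) - ?s x (B y'))"
        using right by (simp add: linear_extension_diff)
    qed (use right in \<open>auto intro!: tensor_relationsI\<close>)
  next
    case sleft
    show ?thesis
    proof (rule sum)
      show "lift_action r = (?s (c \<odot>\<^bsub>V\<^esub> A x) y - Poly_Mapping.single (A x, y) c)
          + (?s (c \<odot>\<^bsub>V\<^esub> x) (B y) - Poly_Mapping.single (x, B y) c)"
        using sleft by (simp add: linear_extension_diff pm_scale_add_right)
    qed (use sleft in \<open>auto intro!: tensor_relationsI\<close>)
  next
    case sright
    show ?thesis
    proof (rule sum)
      show "lift_action r = (?s (A x) (c \<odot>\<^bsub>W\<^esub> y) - Poly_Mapping.single (A x, y) c)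
          + (?s x (c \<odot>\<^bsub>W\<^esub> B y) - Poly_Mapping.single (x, B y) c)"
        using sright by (simp add: linear_extension_diff pm_scale_add_right)
    qed (use sright in \<open>auto intro!: tensor_relationsI\<close>)
  qed
qed

lemma lift_action_K:
  assumes "r \<in> K"
  shows "lift_action r \<in> K"
proof -
  have "submodule complex_field {p \<in> carrier F. lift_action p \<in> K} F"
    by (rule F.preimage_submodule[OF F.cspace_axioms lift_action_linear K_submodule])
  moreover have "tensor_relations V W \<subseteq> {p \<in> carrier F. lift_action p \<in> K}"
    using relations_in lift_action_relation by auto
  ultimately show ?thesis
    using F.span_is_subset assms unfolding tensor_kernel_def by blast
qed

lemma tensor_action_linear:
  "tensor_action V W A B \<in> linear_maps (tensor_space V W) (tensor_space V W)"
  unfolding tensor_action_def lift_action_eq tensor_space_eq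
  by (rule T.quot_map_linear[OF lift_action_linear lift_action_K])

lemma tensor_action_pure:
  assumes "x \<in> carrier V" "y \<in> carrier W"
  shows "tensor_action V W A B (pure x y)
    = pure (A x) y \<oplus>\<^bsub>tensor_space V W\<^esub> pure x (B y)"
  using assms unfolding tensor_action_def lift_action_eq tensor_space_eq pure_def
  by (subst T.quot_map_coset[OF lift_action_linear lift_action_K])
     (auto simp: F.single_in T.quot_add linear_map_in[OF A] linear_map_in[OF B])

end
end

section \<open>Symmetric algebras\<close>

lemma pm_scale_eq_mult: "pm_scale c p = Poly_Mapping.single {#} c * p"
  by (simp add: pm_scale_def mult_map_scale_conv_mult)

lemma pm_scale_sum_mset: "pm_scale c (\<Sum>v\<in>#m. f v) = (\<Sum>v\<in>#m. pm_scale c (f v))"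
  by (induction m) (simp_all add: pm_scale_add_right pm_scale_eq_mult)

lemma poly_mapping_add_induct:
  assumes "P 0" "\<And>k c. P (Poly_Mapping.single k c)" "\<And>p q. P p \<Longrightarrow> P q \<Longrightarrow> P (p + q)"
  shows "P (p :: 'b \<Rightarrow>\<^sub>0 complex)"
proof -
  have "P (\<Sum>k\<in>A. Poly_Mapping.single k (Poly_Mapping.lookup p k))" if "finite A" for A
    using that by (induction A) (auto intro: assms)
  then show ?thesis using poly_mapping_sum_single[of p] by (metis finite_keys)
qed

text \<open>
  The derivation extending \<open>T\<close>, evaluated at a monomial.
\<close>

definition leibniz :: "('v \<Rightarrow> 'v) \<Rightarrow> 'v multiset \<Rightarrow> 'v multiset \<Rightarrow>\<^sub>0 complex" where
  "leibniz T m = (\<Sum>v\<in>#m. Poly_Mapping.single (add_mset (T v) (m - {#v#})) 1)"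

lemma leibniz_single [simp]: "leibniz T {#x#} = Poly_Mapping.single {#T x#} 1"
  by (simp add: leibniz_def)

lemma leibniz_add:
  "leibniz T (m + n) =
     leibniz T m * Poly_Mapping.single n 1 + Poly_Mapping.single m 1 * leibniz T n"
proof -
  have "(\<Sum>v\<in>#m. Poly_Mapping.single (add_mset (T v) (m + n - {#v#})) (1::complex))
      = leibniz T m * Poly_Mapping.single n 1"
    unfolding leibniz_def sum_mset_distrib_right
    by (intro arg_cong[of _ _ sum_mset] image_mset_cong) (simp add: mult_single)
  moreover have "(\<Sum>v\<in>#n. Poly_Mapping.single (add_mset (T v) (m + n - {#v#})) (1::complex))
      = Poly_Mapping.single m 1 * leibniz T n"
    unfolding leibniz_def sum_mset_distrib_left
    by (intro arg_cong[of _ _ sum_mset] image_mset_cong) (simp add: mult_single)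
  ultimately show ?thesis by (simp add: leibniz_def)
qed

definition derivation :: "('v \<Rightarrow> 'v) \<Rightarrow> ('v multiset \<Rightarrow>\<^sub>0 complex) \<Rightarrow> 'v multiset \<Rightarrow>\<^sub>0 complex" where
  "derivation T = linear_extension (leibniz T)"

text \<open>
  Both sides are bilinear in \<open>p\<close> and \<open>q\<close>, which reduces the claim to monomials, that is, to
  \<open>leibniz_add\<close>.
\<close>

lemma derivation_mult: "derivation T (p * q) = derivation T p * q + p * derivation T q"
proof (induction p rule: poly_mapping_add_induct)
  case 1
  then show ?case by (simp add: derivation_def linear_extension_def)
next
  case (2 m c)
  show ?case
  proof (induction q rule: poly_mapping_add_induct)
    case 1
    then show ?case by (simp add: derivation_def linear_extension_def)
  next
    case (2 n d)
    have s: "Poly_Mapping.single k b = pm_scale b (Poly_Mapping.single k 1)" for k :: "'a multiset" and b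
      by simp
    have sc: "pm_scale a p * pm_scale b q = pm_scale (a * b) (p * q)" for a b and p q :: "'a multiset \<Rightarrow>\<^sub>0 complex"
      unfolding pm_scale_scale[symmetric] by (simp only: pm_scale_eq_mult ac_simps)
    show ?case
      unfolding derivation_def
      by (subst (3 4) s)
         (simp only: mult_single linear_extension_single sc leibniz_add pm_scale_add_right)
  next
    case (3 p q)
    then show ?case by (simp add: derivation_def linear_extension_add algebra_simps)
  qed
next
  case (3 p q)
  then show ?case by (simp add: derivation_def linear_extension_add algebra_simps)
qed

lemma sym_relationsI:
  "x \<in> carrier V \<Longrightarrow> y \<in> carrier V \<Longrightarrow>
    Poly_Mapping.single {#x \<oplus>\<^bsub>V\<^esub> y#} 1 - Poly_Mapping.single {#x#} 1 - Poly_Mapping.single {#y#} 1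
      \<in> sym_relations V"
  "x \<in> carrier V \<Longrightarrow>
    Poly_Mapping.single {#c \<odot>\<^bsub>V\<^esub> x#} 1 - Poly_Mapping.single {#x#} c \<in> sym_relations V"
  unfolding sym_relations_def by blast+

locale symmetric_algebra = V: cspace V for V :: "(complex, 'v) module"
begin

abbreviation "P \<equiv> poly_alg (carrier V)"
abbreviation "I \<equiv> sym_ideal V"
abbreviation "Mon \<equiv> {m. set_mset m \<subseteq> carrier V}"

lemma mult_P [simp]: "p \<otimes>\<^bsub>P\<^esub> q = p * q" and one_P [simp]: "\<one>\<^bsub>P\<^esub> = 1"
  by (simp_all add: poly_alg_def)

sublocale P: coeff_space P Mon
  by unfold_locales (auto simp: poly_alg_def pm_scale_eq_mult)

lemma mult_in: "p \<in> carrier P \<Longrightarrow> q \<in> carrier P \<Longrightarrow> p * q \<in> carrier P"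
  using keys_mult[of p q] unfolding P.carrier_eq by force

lemma cring_P: "cring P"
proof (intro cringI comm_monoidI P.M.abelian_group_axioms)
  show "\<one>\<^bsub>P\<^esub> \<in> carrier P" by (simp add: P.carrier_eq)
qed (auto simp: mult_in algebra_simps)

sublocale R: cring P by (rule cring_P)

lemma relations_in: "sym_relations V \<subseteq> carrier P"
  unfolding sym_relations_def by (auto intro!: P.diff_in P.single_in)

lemma ideal_I: "ideal I P"
  unfolding sym_ideal_def by (rule R.genideal_ideal[OF relations_in])

sublocale I: ideal I P by (rule ideal_I)

lemma relations_I: "r \<in> sym_relations V \<Longrightarrow> r \<in> I"
  unfolding sym_ideal_def using R.genideal_self[OF relations_in] by blast

lemma I_mult: "p \<in> carrier P \<Longrightarrow> r \<in> I \<Longrightarrow> p * r \<in> I"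
  using I.I_l_closed by simp

lemma I_add: "r \<in> I \<Longrightarrow> s \<in> I \<Longrightarrow> r + s \<in> I"
  using I.a_closed by simp

lemma I_submodule: "submodule complex_field I P"
proof (rule P.submoduleI')
  show "\<zero>\<^bsub>P\<^esub> \<in> I" by (rule I.zero_closed)
  show "c \<odot>\<^bsub>P\<^esub> r \<in> I" if "r \<in> I" for c r
    using I_mult[OF P.single_in that] by (simp add: pm_scale_eq_mult)
qed (use I.a_subset I_add in auto)

sublocale S: coeff_quot P Mon I
  by (intro coeff_quot.intro csubspace.intro P.coeff_space_axioms P.cspace_axioms I_submodule)

lemma sym_alg_eq: "sym_alg V = S.Q"
  by (simp add: sym_alg_def)

lemma cspace_sym: "cspace (sym_alg V)"
  unfolding sym_alg_eq by (rule S.cspace_quot)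

definition monomial :: "'v multiset \<Rightarrow> ('v multiset \<Rightarrow>\<^sub>0 complex) set" where
  "monomial m = I +>\<^bsub>P\<^esub> Poly_Mapping.single m 1"

lemma monomial_in: "set_mset m \<subseteq> carrier V \<Longrightarrow> monomial m \<in> carrier (sym_alg V)"
  by (simp add: monomial_def sym_alg_eq S.carrier_quot P.single_in)

text \<open>
  The relations of the symmetric algebra, multiplied by a monomial: the class of a monomial is linear
  in each of its factors.
\<close>

lemma monomial_linear:
  assumes m: "set_mset m \<subseteq> carrier V"
  shows "(\<lambda>x. monomial (add_mset x m)) \<in> linear_maps V (sym_alg V)"
proof (rule linear_mapsI)
  fix x y assume xy: "x \<in> carrier V" "y \<in> carrier V"
  have "Poly_Mapping.single m 1 * (Poly_Mapping.single {#x \<oplus>\<^bsub>V\<^esub> y#} 1 - Poly_Mapping.single {#x#} 1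
      - Poly_Mapping.single {#y#} 1) \<in> I"
    using m xy by (intro I_mult P.single_in relations_I sym_relationsI) auto
  then have "Poly_Mapping.single (add_mset (x \<oplus>\<^bsub>V\<^esub> y) m) 1
      - (Poly_Mapping.single (add_mset x m) 1 + Poly_Mapping.single (add_mset y m) 1) \<in> I"
    by (simp add: algebra_simps mult_single)
  then show "monomial (add_mset (x \<oplus>\<^bsub>V\<^esub> y) m)
      = monomial (add_mset x m) \<oplus>\<^bsub>sym_alg V\<^esub> monomial (add_mset y m)"
    using m xy unfolding monomial_def sym_alg_eq
    by (subst S.quot_add) (auto simp: P.single_in P.add_in intro!: S.coset_eq)
next
  fix c x assume x: "x \<in> carrier V"
  have "Poly_Mapping.single m 1 * (Poly_Mapping.single {#c \<odot>\<^bsub>V\<^esub> x#} 1 - Poly_Mapping.single {#x#} c) \<in> I"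
    using m x by (intro I_mult P.single_in relations_I sym_relationsI) auto
  then have "Poly_Mapping.single (add_mset (c \<odot>\<^bsub>V\<^esub> x) m) 1
      - Poly_Mapping.single (add_mset x m) c \<in> I"
    by (simp add: right_diff_distrib mult_single)
  then show "monomial (add_mset (c \<odot>\<^bsub>V\<^esub> x) m) = c \<odot>\<^bsub>sym_alg V\<^esub> monomial (add_mset x m)"
    using m x unfolding monomial_def sym_alg_eq
    by (subst S.quot_smult) (auto simp: P.single_in intro!: S.coset_eq)
qed (use m in \<open>auto intro!: monomial_in\<close>)

text \<open>
  Expand the factors of an arbitrary monomial one at a time: in the induction the first part \<open>m\<close> has
  arbitrary vectors as factors and \<open>image_mset e n\<close> collects those already taken from the family.
\<close>

lemma span_monomials:
  fixes e :: "'b \<Rightarrow> 'v"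
  assumes e: "\<And>b. e b \<in> carrier V" and gen: "V.span (range e) = carrier V"
  shows "module.span complex_field (sym_alg V) (range (\<lambda>m. monomial (image_mset e m)))
    = carrier (sym_alg V)"
proof -
  interpret Q: cspace "sym_alg V" by (rule cspace_sym)
  have sub: "range (\<lambda>m. monomial (image_mset e m)) \<subseteq> carrier (sym_alg V)"
    using e by (auto intro!: monomial_in)
  let ?U = "Q.span (range (\<lambda>m. monomial (image_mset e m)))"
  have U: "submodule complex_field ?U (sym_alg V)" by (rule Q.span_is_submodule[OF sub])
  have "monomial (m + image_mset e n) \<in> ?U" if "set_mset m \<subseteq> carrier V" for m n
    using that
  proof (induction m arbitrary: n)
    case empty
    then show ?case using Q.in_own_span[OF sub] by auto
  next
    case (add x m)
    let ?X = "{x \<in> carrier V. monomial (add_mset x (m + image_mset e n)) \<in> ?U}"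
    have "submodule complex_field ?X V"
      using add.prems e by (intro V.preimage_submodule[OF cspace_sym monomial_linear U]) auto
    moreover have "range e \<subseteq> ?X"
    proof safe
      fix b
      show "monomial (add_mset (e b) (m + image_mset e n)) \<in> ?U"
        using add.IH[of "add_mset b n"] add.prems by simp
    qed (rule e)
    ultimately have "V.span (range e) \<subseteq> ?X" by (intro V.span_is_subset)
    then show ?case using gen add.prems by auto
  qed
  from this[of _ "{#}"] have "I +>\<^bsub>P\<^esub> Poly_Mapping.single m 1 \<in> ?U" if "m \<in> Mon" for m
    using that by (simp add: monomial_def)
  then show ?thesis using S.quot_full[OF U[unfolded sym_alg_eq]] by (simp add: sym_alg_eq)
qed

context
  fixes T assumes T: "T \<in> linear_maps V V"
begin

lemma derivation_eq:
  "(\<lambda>p. \<Sum>m\<in>Poly_Mapping.keys p. \<Sum>v\<in>#m.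
      Poly_Mapping.single (add_mset (T v) (m - {#v#})) (Poly_Mapping.lookup p m)) = derivation T"
  by (rule ext) (simp add: derivation_def linear_extension_def leibniz_def pm_scale_sum_mset)

lemma leibniz_in: "set_mset m \<subseteq> carrier V \<Longrightarrow> leibniz T m \<in> carrier P"
proof (induction m)
  case empty
  then show ?case using P.zero_closed by (simp add: leibniz_def)
next
  case (add x m)
  have "leibniz T ({#x#} + m) \<in> carrier P"
    unfolding leibniz_add using add linear_map_in[OF T]
    by (intro P.add_in mult_in) (auto intro!: P.single_in)
  then show ?case by simp
qed

lemma derivation_linear: "derivation T \<in> linear_maps P P"
  unfolding derivation_def by (rule P.linear_extension_linear) (simp add: leibniz_in)

lemma derivation_relation: "r \<in> sym_relations V \<Longrightarrow> derivation T r \<in> I"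
  unfolding sym_relations_def
  by (auto simp: derivation_def linear_extension_diff linear_map_in[OF T] linear_map_add[OF T]
      linear_map_smult[OF T] intro!: relations_I sym_relationsI)

text \<open>
  The elements of the ideal that the derivation maps into the ideal form an ideal themselves, by the
  product rule; it contains the generators.
\<close>

lemma derivation_I:
  assumes "r \<in> I"
  shows "derivation T r \<in> I"
proof -
  let ?J = "{r \<in> I. derivation T r \<in> I}"
  have "submodule complex_field {p \<in> carrier P. derivation T p \<in> I} P"
    by (rule P.preimage_submodule[OF P.cspace_axioms derivation_linear I_submodule])
  then have "submodule complex_field ?J P"
    using I_submodule unfolding submodule_def by auto
  then interpret J: csubspace P ?J by (intro csubspace.intro P.cspace_axioms)
  have "ideal ?J P"
  proof (rule idealI[OF R.ring_axioms])
    show "subgroup ?J (add_monoid P)"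
      using J.additive_subgroup by (simp add: additive_subgroup_def)
  next
    fix r p assume r: "r \<in> ?J" and p: "p \<in> carrier P"
    have Dp: "derivation T p \<in> carrier P" using linear_map_in[OF derivation_linear p] .
    have "derivation T (p * r) \<in> I"
      unfolding derivation_mult using r p Dp by (intro I_add I_mult) auto
    then show "p \<otimes>\<^bsub>P\<^esub> r \<in> ?J" "r \<otimes>\<^bsub>P\<^esub> p \<in> ?J"
      using r p I_mult by (auto simp: mult.commute)
  qed
  moreover have "sym_relations V \<subseteq> ?J" using relations_I derivation_relation by auto
  ultimately have "Idl\<^bsub>P\<^esub> (sym_relations V) \<subseteq> ?J" by (rule R.genideal_minimal)
  then show ?thesis using assms unfolding sym_ideal_def by auto
qed

lemma sym_action_linear: "sym_action V T \<in> linear_maps (sym_alg V) (sym_alg V)"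
  unfolding sym_action_def derivation_eq sym_alg_eq
  by (rule S.quot_map_linear[OF derivation_linear derivation_I])

text \<open>
  In the quotient, each factor \<open>T (e b)\<close> can be replaced by \<open>wt b\<close> times \<open>e b\<close>, so the Leibniz rule
  adds up the eigenvalues of the factors. The index multiset \<open>m\<close> is used for the sum because
  \<open>e\<close> may identify indices.
\<close>

lemma sym_action_monomial:
  fixes e :: "'b \<Rightarrow> 'v"
  assumes e: "\<And>b. e b \<in> carrier V" and eig: "\<And>b. T (e b) = wt b \<odot>\<^bsub>V\<^esub> e b"
  shows "sym_action V T (monomial (image_mset e m)) =
    (\<Sum>b\<in>#m. wt b) \<odot>\<^bsub>sym_alg V\<^esub> monomial (image_mset e m)"
proof -
  have in_P: "Poly_Mapping.single (image_mset e m) c \<in> carrier P" for m c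
    using e by (intro P.single_in) auto
  have "leibniz T (image_mset e m) - Poly_Mapping.single (image_mset e m) (\<Sum>b\<in>#m. wt b) \<in> I"
  proof (induction m)
    case empty
    then show ?case using I.zero_closed by (simp add: leibniz_def)
  next
    case (add b m)
    let ?m = "image_mset e m"
    have "Poly_Mapping.single {#e b#} 1 \<in> carrier P" using e by (intro P.single_in) auto
    moreover have "Poly_Mapping.single {#wt b \<odot>\<^bsub>V\<^esub> e b#} 1 - Poly_Mapping.single {#e b#} (wt b) \<in> I"
      using e by (intro relations_I sym_relationsI)
    ultimately have "Poly_Mapping.single ?m 1
          * (Poly_Mapping.single {#wt b \<odot>\<^bsub>V\<^esub> e b#} 1 - Poly_Mapping.single {#e b#} (wt b))
        + Poly_Mapping.single {#e b#} 1
          * (leibniz T ?m - Poly_Mapping.single ?m (\<Sum>b\<in>#m. wt b)) \<in> I"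
      using add in_P by (intro I_add I_mult)
    also have "Poly_Mapping.single ?m 1
          * (Poly_Mapping.single {#wt b \<odot>\<^bsub>V\<^esub> e b#} 1 - Poly_Mapping.single {#e b#} (wt b))
        + Poly_Mapping.single {#e b#} 1
          * (leibniz T ?m - Poly_Mapping.single ?m (\<Sum>b\<in>#m. wt b))
        = leibniz T ({#e b#} + ?m) - Poly_Mapping.single ({#e b#} + ?m) (wt b + (\<Sum>b\<in>#m. wt b))"
      unfolding leibniz_add
      by (simp add: eig right_diff_distrib mult_single single_add)
    finally show ?case by simp
  qed
  then have "I +>\<^bsub>P\<^esub> leibniz T (image_mset e m) =
      I +>\<^bsub>P\<^esub> Poly_Mapping.single (image_mset e m) (\<Sum>b\<in>#m. wt b)"
    by (rule S.coset_eq[OF in_P])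
  then show ?thesis
    unfolding sym_action_def derivation_eq sym_alg_eq monomial_def
    by (subst S.quot_map_coset[OF derivation_linear derivation_I])
       (auto simp: in_P S.quot_smult derivation_def)
qed

end
end

section \<open>Multiplicities in a twisted symmetric algebra\<close>

text \<open>
  If one operator of \<open>h\<close> already separates the monomials in a family \<open>e\<close> that spans \<open>V\<close>, then the
  tensors \<open>1 \<otimes> monomial\<close> span the target and have pairwise different eigenvalues, the twist
  adding the same constant \<open>\<xi> H\<close> to all of them. Hence its eigenspaces, and all the more the
  simultaneous ones, are at most lines. The monomials are indexed by multisets of indices, not of
  vectors, because \<open>e\<close> may identify indices.
\<close>

lemma vs_dim_hom_twisted_sym_alg_le_1:
  fixes e :: "'b \<Rightarrow> 'v" and wt :: "'b \<Rightarrow> complex"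
  assumes "cspace V"
    and T: "\<And>H. H \<in> h \<Longrightarrow> T H \<in> linear_maps V V"
    and H: "H \<in> h"
    and e: "\<And>b. e b \<in> carrier V" "\<And>b. T H (e b) = wt b \<odot>\<^bsub>V\<^esub> e b"
    and gen: "module.span complex_field V (range e) = carrier V"
    and inj: "inj (\<lambda>m. \<Sum>b\<in>#m. wt b)"
  shows "vs_dim (hom_space h complex_line (\<lambda>H z. \<mu> H * z)
      (tensor_space complex_line (sym_alg V))
      (\<lambda>H. tensor_action complex_line (sym_alg V) (\<lambda>z. \<xi> H * z) (sym_action V (T H)))) \<le> 1"
proof -
  interpret V: symmetric_algebra V
    using assms(1) by (simp add: symmetric_algebra_def)
  interpret W: tensor_product complex_line "sym_alg V"
    by (intro tensor_product.intro cspace_complex_line V.cspace_sym)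
  let ?W = "tensor_space complex_line (sym_alg V)"
  let ?\<sigma> = "\<lambda>H. tensor_action complex_line (sym_alg V) (\<lambda>z. \<xi> H * z) (sym_action V (T H))"
  interpret C: cspace ?W by (rule W.cspace_tensor)
  have twist: "(\<lambda>z. \<xi> H * z) \<in> linear_maps complex_line complex_line" for H
    by (rule linear_mapsI) (auto simp: algebra_simps)
  have \<sigma>: "?\<sigma> H \<in> linear_maps ?W ?W" if "H \<in> h" for H
    by (rule W.tensor_action_linear[OF twist V.sym_action_linear[OF T[OF that]]])
  let ?mon = "\<lambda>m. V.monomial (image_mset e m)"
  let ?E = "\<lambda>m. W.pure 1 (?mon m)"
  have mon_in: "?mon m \<in> carrier (sym_alg V)" for m
    using e by (intro V.monomial_in) auto
  have E_in: "?E m \<in> carrier ?W" for m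
    using mon_in by (intro W.pure_in) auto
  have twisted: "W.pure z s = z \<odot>\<^bsub>?W\<^esub> W.pure 1 s" if "s \<in> carrier (sym_alg V)" for z s
    using W.pure_smult_left[of 1 s z] that by simp
  have eigen: "?\<sigma> H (?E m) = (\<xi> H + (\<Sum>b\<in>#m. wt b)) \<odot>\<^bsub>?W\<^esub> ?E m" for m
  proof -
    have "?\<sigma> H (?E m) = W.pure (\<xi> H) (?mon m) \<oplus>\<^bsub>?W\<^esub> W.pure 1 (sym_action V (T H) (?mon m))"
      using W.tensor_action_pure[OF twist V.sym_action_linear[OF T[OF H]], of 1 "?mon m" H] mon_in
      by simp
    also have "sym_action V (T H) (?mon m) = (\<Sum>b\<in>#m. wt b) \<odot>\<^bsub>sym_alg V\<^esub> ?mon m"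
      by (rule V.sym_action_monomial[OF T[OF H] e])
    also have "W.pure 1 \<dots> = (\<Sum>b\<in>#m. wt b) \<odot>\<^bsub>?W\<^esub> ?E m"
      using mon_in by (intro W.pure_smult_right) auto
    also have "W.pure (\<xi> H) (?mon m) = \<xi> H \<odot>\<^bsub>?W\<^esub> ?E m"
      by (rule twisted[OF mon_in])
    finally show ?thesis using E_in by (simp only: C.smult_add_left)
  qed
  have span: "C.span (range ?E) = carrier ?W"
  proof (rule W.tensor_full)
    have sub: "range ?E \<subseteq> carrier ?W" using E_in by auto
    then show U: "submodule complex_field (C.span (range ?E)) ?W" by (rule C.span_is_submodule)
    interpret U: submodule complex_field "C.span (range ?E)" ?W by (rule U)
    fix z s assume s: "s \<in> carrier (sym_alg V)"
    let ?X = "{s \<in> carrier (sym_alg V). W.pure 1 s \<in> C.span (range ?E)}"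
    have "submodule complex_field ?X (sym_alg V)"
      by (rule W.W.preimage_submodule[OF W.cspace_tensor W.pure_right_linear U]) simp
    moreover have "range ?mon \<subseteq> ?X" using mon_in C.in_own_span[OF sub] by auto
    ultimately have "W.W.span (range ?mon) \<subseteq> ?X" by (intro W.W.span_is_subset)
    then have "W.pure 1 s \<in> C.span (range ?E)"
      using s V.span_monomials[of e] e gen by auto
    then show "W.pure z s \<in> C.span (range ?E)"
      by (subst twisted[OF s]) (intro U.smult_closed, auto)
  qed
  have "inj (\<lambda>m. \<xi> H + (\<Sum>b\<in>#m. wt b))" using inj by (auto simp: inj_def)
  then obtain w where w: "w \<in> carrier ?W"
    "\<And>x. x \<in> carrier ?W \<Longrightarrow> ?\<sigma> H x = \<mu> H \<odot>\<^bsub>?W\<^esub> x \<Longrightarrow> \<exists>c. x = c \<odot>\<^bsub>?W\<^esub> w"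
    using C.eigenspace_in_line[OF \<sigma>[OF H] E_in eigen _ span] by metis
  show ?thesis
    by (rule vs_dim_hom_complex_line_le_1[OF W.cspace_tensor \<sigma> w(1)]) (use w(2) H in auto)
qed

section \<open>The quotients of the strictly lower triangular matrices\<close>

lemma mat_space_simps [simp]:
  "carrier (mat_space S) = S" "(\<oplus>\<^bsub>mat_space S\<^esub>) = (+)" "\<zero>\<^bsub>mat_space S\<^esub> = 0"
  "c \<odot>\<^bsub>mat_space S\<^esub> A = (\<chi> j k. c * A $ j $ k)"
  by (simp_all add: mat_space_def)

lemma forall_3: "(\<forall>j::3. P j) \<longleftrightarrow> P 1 \<and> P 2 \<and> P 3"
  by (metis exhaust_3)

lemma mat3_eq_iff: "A = B \<longleftrightarrow> (\<forall>j k. A $ j $ k = (B :: 'a^3^3) $ j $ k)"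
  by (simp add: vec_eq_iff)

lemma n_minus_iff:
  "A \<in> n_minus \<longleftrightarrow> A$1$1 = 0 \<and> A$1$2 = 0 \<and> A$1$3 = 0 \<and> A$2$2 = 0 \<and> A$2$3 = 0 \<and> A$3$3 = 0"
  by (auto simp: n_minus_def mat3_eq_iff forall_3)

text \<open>
  The row and the column of the two entries below the diagonal that lie outside the \<open>i\<close>-th copy of
  \<open>gl(2)\<close>, labelled by truth values; every \<open>i\<close> other than \<open>1\<close> and \<open>2\<close> means the third copy, as it does
  in \<open>iota\<close>.
\<close>

definition outer_pos :: "nat \<Rightarrow> bool \<Rightarrow> 3 \<times> 3" where
  "outer_pos i b =
     (if i = 1 then (3, if b then 1 else 2)
      else if i = 2 then (if b then 2 else 3, 1)
      else if b then (2, 1) else (3, 2))"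

abbreviation row :: "nat \<Rightarrow> bool \<Rightarrow> 3" where
  "row i b \<equiv> fst (outer_pos i b)"

abbreviation col :: "nat \<Rightarrow> bool \<Rightarrow> 3" where
  "col i b \<equiv> snd (outer_pos i b)"

abbreviation root_value :: "nat \<Rightarrow> bool \<Rightarrow> complex^3^3 \<Rightarrow> complex" where
  "root_value i b H \<equiv> H $ row i b $ row i b - H $ col i b $ col i b"

lemma g_sub_iff:
  "A \<in> g_sub i \<longleftrightarrow>
     (if i = 1 then A$1$3 = 0 \<and> A$2$3 = 0 \<and> A$3$3 = 0 \<and> A$3$1 = 0 \<and> A$3$2 = 0
      else if i = 2 then A$1$1 = 0 \<and> A$1$2 = 0 \<and> A$1$3 = 0 \<and> A$2$1 = 0 \<and> A$3$1 = 0
      else A$1$2 = 0 \<and> A$2$1 = 0 \<and> A$2$2 = 0 \<and> A$2$3 = 0 \<and> A$3$2 = 0)"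
  (is "_ \<longleftrightarrow> ?R")
proof
  show "A \<in> g_sub i \<Longrightarrow> ?R" by (auto simp: g_sub_def iota_def)
next
  assume R: ?R
  define p :: "2 \<Rightarrow> 3" where
    "p = (\<lambda>j. if i = 1 then (if j = 1 then 1 else 2) else if i = 2 then (if j = 1 then 2 else 3)
      else (if j = 1 then 1 else 3))"
  have "A = iota i (\<chi> j k. A $ p j $ p k)"
    using R by (auto simp: iota_def mat3_eq_iff forall_3 p_def split: if_splits)
  then show "A \<in> g_sub i" by (auto simp: g_sub_def)
qed

lemma n_minus_sub_iff:
  "A \<in> n_minus_sub i \<longleftrightarrow> A \<in> n_minus \<and>
     (\<forall>b. A $ row i b $ col i b = 0)"
  by (auto simp: n_minus_sub_def n_minus_iff g_sub_iff outer_pos_def all_bool_eq split: if_splits)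

lemma diag_subalg_iff:
  "H \<in> diag_subalg \<longleftrightarrow> (\<forall>j k. j \<noteq> k \<longrightarrow> H $ j $ k = 0)"
  by (auto simp: diag_subalg_def mat3_eq_iff forall_3)

lemma lie_bracket_diag:
  assumes "H \<in> diag_subalg"
  shows "lie_bracket H A $ j $ k = (H $ j $ j - H $ k $ k) * A $ j $ k"
proof -
  have "(\<Sum>l\<in>UNIV. H $ j $ l * A $ l $ k) = (\<Sum>l\<in>UNIV. if l = j then H $ j $ j * A $ j $ k else 0)"
    by (rule sum.cong) (use assms in \<open>auto simp: diag_subalg_iff\<close>)
  moreover have "(\<Sum>l\<in>UNIV. A $ j $ l * H $ l $ k) = (\<Sum>l\<in>UNIV. if l = k then A $ j $ k * H $ k $ k else 0)"
    by (rule sum.cong) (use assms in \<open>auto simp: diag_subalg_iff\<close>)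
  ultimately show ?thesis
    by (simp add: lie_bracket_def matrix_matrix_mult_def algebra_simps)
qed

lemma cspace_mat_n_minus: "cspace (mat_space n_minus)"
  by (rule cspaceI) (auto simp: n_minus_iff vec_eq_iff algebra_simps)

lemma csubspace_n_minus_sub: "csubspace (mat_space n_minus) (n_minus_sub i)"
proof -
  interpret cspace "mat_space n_minus" by (rule cspace_mat_n_minus)
  show ?thesis
    by (intro csubspace.intro cspace_axioms submoduleI')
       (auto simp: n_minus_sub_iff n_minus_iff)
qed

lemma lie_bracket_linear:
  assumes "H \<in> diag_subalg"
  shows "lie_bracket H \<in> linear_maps (mat_space n_minus) (mat_space n_minus)"
  by (rule linear_mapsI)
     (auto simp: n_minus_iff lie_bracket_diag[OF assms] vec_eq_iff algebra_simps)

lemma n_quot_action_linear: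
  assumes "H \<in> diag_subalg"
  shows "n_quot_action i H \<in> linear_maps (n_quot i) (n_quot i)"
proof -
  interpret csubspace "mat_space n_minus" "n_minus_sub i" by (rule csubspace_n_minus_sub)
  show ?thesis unfolding n_quot_action_def n_quot_def
    by (rule quot_map_linear[OF lie_bracket_linear[OF assms]])
       (auto simp: n_minus_sub_iff n_minus_iff lie_bracket_diag[OF assms])
qed

definition outer_vec :: "nat \<Rightarrow> bool \<Rightarrow> complex^3^3" where
  "outer_vec i b = (\<chi> j k. if (j, k) = outer_pos i b then 1 else 0)"

definition outer_class :: "nat \<Rightarrow> bool \<Rightarrow> (complex^3^3) set" where
  "outer_class i b = n_minus_sub i +>\<^bsub>mat_space n_minus\<^esub> outer_vec i b"

lemma outer_vec_in: "outer_vec i b \<in> n_minus"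
  by (auto simp: n_minus_iff outer_vec_def outer_pos_def)

lemma cspace_n_quot: "cspace (n_quot i)"
  unfolding n_quot_def by (rule csubspace.cspace_quot[OF csubspace_n_minus_sub])

lemma outer_class_in: "outer_class i b \<in> carrier (n_quot i)"
  unfolding n_quot_def outer_class_def
  using csubspace.carrier_quot[OF csubspace_n_minus_sub] outer_vec_in by auto

lemma n_quot_action_outer_class:
  assumes H: "H \<in> diag_subalg"
  shows "n_quot_action i H (outer_class i b) =
    root_value i b H \<odot>\<^bsub>n_quot i\<^esub> outer_class i b"
proof -
  interpret csubspace "mat_space n_minus" "n_minus_sub i" by (rule csubspace_n_minus_sub)
  have bracket: "lie_bracket H (outer_vec i b) =
      root_value i b H \<odot>\<^bsub>mat_space n_minus\<^esub> outer_vec i b"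
    by (cases "outer_pos i b") (auto simp: vec_eq_iff lie_bracket_diag[OF H] outer_vec_def)
  have "n_quot_action i H (outer_class i b) =
      n_minus_sub i +>\<^bsub>mat_space n_minus\<^esub> lie_bracket H (outer_vec i b)"
    unfolding n_quot_action_def outer_class_def
    by (rule quot_map_coset[OF lie_bracket_linear[OF H]])
       (use outer_vec_in in \<open>auto simp: n_minus_sub_iff n_minus_iff lie_bracket_diag[OF H]\<close>)
  also note bracket
  also have "n_minus_sub i +>\<^bsub>mat_space n_minus\<^esub>
      (root_value i b H \<odot>\<^bsub>mat_space n_minus\<^esub> outer_vec i b) =
      root_value i b H \<odot>\<^bsub>n_quot i\<^esub> outer_class i b"
    unfolding outer_class_def n_quot_def
    by (rule quot_smult[symmetric]) (simp add: outer_vec_in)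
  finally show ?thesis .
qed

lemma span_outer_class:
  "module.span complex_field (n_quot i) (range (outer_class i)) = carrier (n_quot i)"
proof
  interpret csubspace "mat_space n_minus" "n_minus_sub i" by (rule csubspace_n_minus_sub)
  interpret Q: cspace "n_quot i" by (rule cspace_n_quot)
  have sub: "range (outer_class i) \<subseteq> carrier (n_quot i)" using outer_class_in by auto
  interpret S: submodule complex_field "Q.span (range (outer_class i))" "n_quot i"
    by (rule Q.span_is_submodule[OF sub])
  show "Q.span (range (outer_class i)) \<subseteq> carrier (n_quot i)" by (rule S.subset)
  show "carrier (n_quot i) \<subseteq> Q.span (range (outer_class i))"
  proof
    fix X assume "X \<in> carrier (n_quot i)"
    then obtain A where A: "A \<in> n_minus" "X = n_minus_sub i +>\<^bsub>mat_space n_minus\<^esub> A"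
      by (auto simp: n_quot_def carrier_quot)
    define c where "c = (\<lambda>b. A $ row i b $ col i b)"
    define B where "B = c True \<odot>\<^bsub>mat_space n_minus\<^esub> outer_vec i True
      \<oplus>\<^bsub>mat_space n_minus\<^esub> c False \<odot>\<^bsub>mat_space n_minus\<^esub> outer_vec i False"
    have "B \<in> n_minus" unfolding B_def using outer_vec_in by (auto simp: n_minus_iff)
    moreover have "A - B \<in> n_minus_sub i"
      using A(1) unfolding B_def
      by (auto simp: n_minus_sub_iff n_minus_iff c_def outer_vec_def outer_pos_def all_bool_eq
          split: if_splits)
    ultimately have "X = n_minus_sub i +>\<^bsub>mat_space n_minus\<^esub> B"
      unfolding A(2) by (intro coset_eqI[where n = "A - B"]) auto
    also have "\<dots> = c True \<odot>\<^bsub>n_quot i\<^esub> outer_class i True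
        \<oplus>\<^bsub>n_quot i\<^esub> c False \<odot>\<^bsub>n_quot i\<^esub> outer_class i False"
      using linear_map_add[OF coset_linear, of "c True \<odot>\<^bsub>mat_space n_minus\<^esub> outer_vec i True"
          "c False \<odot>\<^bsub>mat_space n_minus\<^esub> outer_vec i False"]
        linear_map_smult[OF coset_linear, of "outer_vec i True" "c True"]
        linear_map_smult[OF coset_linear, of "outer_vec i False" "c False"]
        smult_in[of "outer_vec i True" "c True"] smult_in[of "outer_vec i False" "c False"] outer_vec_in
      unfolding B_def outer_class_def n_quot_def by (simp only: mat_space_simps(1))
    also have "\<dots> \<in> Q.span (range (outer_class i))"
      using Q.in_own_span[OF sub] by (intro S.m_closed S.smult_closed) auto
    finally show "X \<in> Q.span (range (outer_class i))" .
  qed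
qed

text \<open>
  The two roots are linearly independent on the diagonal matrices of the \<open>i\<close>-th copy of \<open>gl(2)\<close>: up to
  sign, each of them reads off one of the two free diagonal entries, the remaining entry being zero.
  So any two values can be prescribed.
\<close>

lemma separating_element:
  obtains H where "H \<in> a_sub i"
    "\<And>b. root_value i b H = (if b then 1 else \<i>)"
proof
  define d :: "3 \<Rightarrow> complex" where
    "d = (\<lambda>j. if i = 1 then (if j = 1 then -1 else if j = 2 then -\<i> else 0)
      else if i = 2 then (if j = 1 then 0 else if j = 2 then 1 else \<i>)
      else (if j = 1 then -1 else if j = 2 then 0 else \<i>))"
  let ?H = "(\<chi> j k. if j = k then d j else 0) :: complex^3^3"
  show "?H \<in> a_sub i"
    by (auto simp: a_sub_def diag_subalg_iff g_sub_iff d_def)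
  show "root_value i b ?H = (if b then 1 else \<i>)" for b
    by (auto simp: outer_pos_def d_def)
qed

text \<open>
  The real and imaginary parts of a sum of ones and \<open>\<i>\<close>'s count the two kinds of summands.
\<close>

lemma inj_sum_1_imaginary_unit:
  "inj (\<lambda>m. \<Sum>b\<in>#m. if b then 1 else \<i>)"
proof (rule injI)
  have sum: "(\<Sum>b\<in>#m. if b then 1 else \<i>) = Complex (count m True) (count m False)" for m
    by (induction m) (auto simp: complex_eq_iff)
  fix m n :: "bool multiset"
  assume "(\<Sum>b\<in>#m. if b then 1 else \<i>) = (\<Sum>b\<in>#n. if b then 1 else \<i>)"
  then have "count m b = count n b" for b by (cases b) (auto simp: sum)
  then show "m = n" by (rule multiset_eqI)
qed

theorem theoremK:
  fixes i :: nat and lam :: "complex^3" and \<nu> :: "complex^2"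
  assumes "i \<in> {1, 2, 3}"
  shows "branching_mult i \<nu> lam \<le> 1"
proof -
  obtain H where H: "H \<in> a_sub i" "\<And>b. root_value i b H = (if b then 1 else \<i>)"
    using separating_element by blast
  show ?thesis
    unfolding branching_mult_def
  proof (rule vs_dim_hom_twisted_sym_alg_le_1[where H = H and e = "outer_class i"])
    show "n_quot_action i H (outer_class i b) = (if b then 1 else \<i>) \<odot>\<^bsub>n_quot i\<^esub> outer_class i b" for b
      using n_quot_action_outer_class[of H i b] H by (simp add: a_sub_def)
  qed (use H(1) in \<open>auto simp: a_sub_def intro!: n_quot_action_linear outer_class_in
      cspace_n_quot span_outer_class inj_sum_1_imaginary_unit\<close>)
qed

end
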